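(* The divergence operator $\delta$ coincides with the stochastic integral operator $\mathcal{I}$ on square-summable predictable processes: if $X=(X_k)_{k\in\mathbb{N}}\in L^2(\Omega\times\mathbb{N},\mathbb{R}^d)$ is predictable (each $X_k$ is $\mathcal{F}_{k-1}$-measurable), then $$\delta(X)=\mathcal{I}(X)=\sum_{k=0}^\infty\langle X_k,Y_k\rangle .$$
   Context: Let $d\ge 1$, $\Omega=\{0,\dots,d\}^{\mathbb{N}}$ ($0\in\mathbb{N}$) with its product $\sigma$-field $\mathcal{F}$, coordinate maps $X_n^{\mathrm{coord}}(w)=w_n$, $\mathcal{F}_n$ the $\sigma$-field generated by the coordinates $0,\dots,n$, $\mathcal{F}_{-1}=\{\varnothing,\Omega\}$, and $\mathbb{P}$ a probability such that $\mathbb{P}(X_n^{\mathrm{coord}}=i\,|\,\mathcal{F}_{n-1})>0$ for all $n,i$. For each $n$ let $v_0(n),\dots,v_d(n)$ be $\mathcal{F}_{n-1}$-measurable $\mathbb{R}^d$-valued random variables and $Y_n(w)=v_{w_n}(n)(w)$. Assume (obtuse random walk) $\sigma(Y_0,\dots,Y_n)=\mathcal{F}_n$, $\mathbb{E}[Y_n^i\,|\,\mathcal{F}_{n-1}]=0$ and $\mathbb{E}[Y_n^iY_n^j\,|\,\mathcal{F}_{n-1}]=\delta^{ij}$. $\langle\cdot,\cdot\rangle$ is the Euclidean inner product, $L^2(\Omega)=L^2(\Omega,\mathcal{F},\mathbb{P})$, and $L^2(\Omega\times\mathbb{N},\mathbb{R}^d)$ is the space of $\mathbb{R}^d$-valued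 processes $X$ with $\mathbb{E}\sum_k\|X_k\|^2<\infty$. Multiple integrals: $\Delta_r=\{(i_1,\dots,i_r)\in\mathbb{N}^r: i_l\ne i_k \text{ for } l\neq k\}$. A function $f_r=(f_r^{k_1,\dots,k_r}):\Delta_r\to\mathbb{R}^{d^r}$ is symmetric if it is invariant under simultaneous permutation of its arguments $i_1,\dots,i_r$ and its upper indices $k_1,\dots,k_r$. For symmetric $f_r\in L^2(\Delta_r,\mathbb{R}^{d^r})$, $r\ge1$, $\mathcal{I}^r(f_r)=\sum_{k_1,\dots,k_r=1}^d\sum_{(i_1,\dots,i_r)\in\Delta_r}f_r^{k_1,\dots,k_r}(i_1,\dots,i_r)Y_{i_1}^{k_1}\cdots Y_{i_r}^{k_r}$, and $\mathcal{I}^0(f_0)=f_0\in\mathbb{R}$. $\mathcal{S}$ is the (dense in $L^2(\Omega)$) space of finite sums $\sum_{r=0}^n\mathcal{I}^r(f_r)$. Gradient: $D_k=(D_k^1,\dots,D_k^d)$ is linear on $\mathcal{S}$ with $D_k^j\mathcal{I}^0(f_0)=0$, $D_k^j\mathcal{I}^r(f_r)=r\,\mathcal{I}^{r-1}\big(f_r^j( *,k)1_{\Delta_r}( *,k)\big)$, where $f_r^j( *,k)1_{\Delta_r}( *,k)$ has components $(i_1,\dots,i_{r-1})\mapsto f_r^{k_1,\dots,k_{r-1},j}(i_1,\dots,i_{r-1},k)$ if $k\notin\{i_1,\dots,i_{r-1}\}$ and $0$ otherwise; $D_k^j$ is extended to $L^2(\Omega)$ by $L^2$-continuity. Divergence: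 for $X\in L^2(\Omega\times\mathbb{N},\mathbb{R}^d)$, $$\delta(X)=\sum_{k=0}^{\infty}\langle X_k,Y_k\rangle-\sum_{i=1}^d\sum_{k=0}^{\infty}\langle D_k(X_k^i),Y_k\rangle Y_k^i$$ whenever all series converge in $L^2(\Omega)$. The stochastic integral of a square-integrable predictable process $X$ is $\mathcal{I}(X)=\sum_{k\ge0}\langle X_k,Y_k\rangle$, the $L^2(\Omega)$-limit of the partial sums. *)

theory Defs
  imports "HOL-Probability.Probability" "HOL-Combinatorics.Permutations"
begin

subsection \<open>Square-integrable random variables and limits in $L^2$\<close>

text \<open>Elements of $L^2$ are represented by functions, and equality in $L^2$ is equality
  almost everywhere.\<close>

definition L2_space :: "'a measure \<Rightarrow> ('a \<Rightarrow> real) set" where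
  "L2_space M = {f \<in> borel_measurable M. integrable M (\<lambda>w. (f w)\<^sup>2)}"

definition L2_tendsto ::
    "'a measure \<Rightarrow> ('i \<Rightarrow> 'a \<Rightarrow> real) \<Rightarrow> ('a \<Rightarrow> real) \<Rightarrow> 'i filter \<Rightarrow> bool" where
  "L2_tendsto M u S \<F> \<longleftrightarrow>
     S \<in> L2_space M \<and> (\<forall>\<^sub>F x in \<F>. u x \<in> L2_space M) \<and>
     ((\<lambda>x. \<integral>w. (u x w - S w)\<^sup>2 \<partial>M) \<longlongrightarrow> 0) \<F>"

definition L2_lim :: "'a measure \<Rightarrow> ('i \<Rightarrow> 'a \<Rightarrow> real) \<Rightarrow> 'i filter \<Rightarrow> 'a \<Rightarrow> real" where
  "L2_lim M u \<F> = (SOME S. L2_tendsto M u S \<F>)"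

definition L2_summable :: "'a measure \<Rightarrow> (nat \<Rightarrow> 'a \<Rightarrow> real) \<Rightarrow> bool" where
  "L2_summable M u \<longleftrightarrow> (\<exists>S. L2_tendsto M (\<lambda>n w. \<Sum>k<n. u k w) S sequentially)"

definition L2_suminf :: "'a measure \<Rightarrow> (nat \<Rightarrow> 'a \<Rightarrow> real) \<Rightarrow> 'a \<Rightarrow> real" where
  "L2_suminf M u = L2_lim M (\<lambda>n w. \<Sum>k<n. u k w) sequentially"


subsection \<open>The path space and obtuse random walks\<close>

definition path_space :: "nat \<Rightarrow> (nat \<Rightarrow> nat) measure" where
  "path_space d = (\<Pi>\<^sub>M n\<in>UNIV. count_space {0..d})"

definition sigma_generated ::
    "'a set \<Rightarrow> 'i set \<Rightarrow> ('i \<Rightarrow> 'a \<Rightarrow> 'b) \<Rightarrow> 'b measure \<Rightarrow> 'a measure" where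
  "sigma_generated \<Omega> I Z N = sigma \<Omega> (\<Union>i\<in>I. {Z i -` A \<inter> \<Omega> | A. A \<in> sets N})"

text \<open>The index is shifted by one: \<open>past d n\<close> is generated by the coordinates strictly
  before \<open>n\<close>, so it is $\mathcal{F}_{n-1}$, and \<open>past d 0\<close> is the trivial
  $\sigma$-field $\mathcal{F}_{-1}$.\<close>

definition past :: "nat \<Rightarrow> nat \<Rightarrow> (nat \<Rightarrow> nat) measure" where
  "past d n = sigma_generated (space (path_space d)) {..<n} (\<lambda>m w. w m) (count_space {0..d})"

text \<open>\<open>v i n\<close> is the random vector $v_i(n)$; the dimension $d$ is \<open>CARD('d)\<close>.\<close>

definition walk ::
    "(nat \<Rightarrow> nat \<Rightarrow> (nat \<Rightarrow> nat) \<Rightarrow> real ^ 'd) \<Rightarrow> nat \<Rightarrow> (nat \<Rightarrow> nat) \<Rightarrow> real ^ 'd" where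
  "walk v n w = v (w n) n w"

locale obtuse_random_walk = prob_space P
  for P :: "(nat \<Rightarrow> nat) measure"
  and v :: "nat \<Rightarrow> nat \<Rightarrow> (nat \<Rightarrow> nat) \<Rightarrow> real ^ 'd::finite" +
  assumes sets_P: "sets P = sets (path_space CARD('d))"
  and cond_prob_pos: "\<And>n i. i \<le> CARD('d) \<Longrightarrow>
        AE w in P. real_cond_exp P (past CARD('d) n) (indicator {w' \<in> space P. w' n = i}) w > 0"
  and v_measurable: "\<And>n i. i \<le> CARD('d) \<Longrightarrow> v i n \<in> borel_measurable (past CARD('d) n)"
  and sigma_walk: "\<And>n. sets (sigma_generated (space P) {..n} (walk v) borel)
        = sets (past CARD('d) (Suc n))"
  and cond_mean: "\<And>n i.
        AE w in P. real_cond_exp P (past CARD('d) n) (\<lambda>w'. walk v n w' $ i) w = 0"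
  and cond_cov: "\<And>n i j.
        AE w in P. real_cond_exp P (past CARD('d) n) (\<lambda>w'. walk v n w' $ i * walk v n w' $ j) w
          = (if i = j then 1 else 0)"


subsection \<open>Processes and the stochastic integral\<close>

definition L2_process :: "'a measure \<Rightarrow> (nat \<Rightarrow> 'a \<Rightarrow> real ^ 'd::finite) \<Rightarrow> bool" where
  "L2_process M X \<longleftrightarrow> (\<forall>k. X k \<in> borel_measurable M) \<and>
     (\<integral>\<^sup>+w. (\<Sum>k. ennreal ((norm (X k w))\<^sup>2)) \<partial>M) < \<infinity>"

definition predictable :: "(nat \<Rightarrow> (nat \<Rightarrow> nat) \<Rightarrow> real ^ 'd::finite) \<Rightarrow> bool" where
  "predictable X \<longleftrightarrow> (\<forall>k. X k \<in> borel_measurable (past CARD('d) k))"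

definition stochastic_integral ::
    "(nat \<Rightarrow> nat) measure \<Rightarrow> (nat \<Rightarrow> nat \<Rightarrow> (nat \<Rightarrow> nat) \<Rightarrow> real ^ 'd::finite) \<Rightarrow>
     (nat \<Rightarrow> (nat \<Rightarrow> nat) \<Rightarrow> real ^ 'd) \<Rightarrow> (nat \<Rightarrow> nat) \<Rightarrow> real" where
  "stochastic_integral P v X = L2_suminf P (\<lambda>k w. X k w \<bullet> walk v k w)"


subsection \<open>Multiple stochastic integrals\<close>

text \<open>A kernel $f_r$ is a function \<open>f\<close> of the list \<open>ts\<close> of its arguments
  $i_1,\dots,i_r$ and the list \<open>ks\<close> of its upper indices $k_1,\dots,k_r$.  Only its
  values on \<open>Delta r\<close> and on lists \<open>ks\<close> of length \<open>r\<close> matter.\<close>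

definition Delta :: "nat \<Rightarrow> nat list set" where
  "Delta r = {ts. length ts = r \<and> distinct ts}"

definition symmetric_kernel :: "nat \<Rightarrow> (nat list \<Rightarrow> 'd list \<Rightarrow> real) \<Rightarrow> bool" where
  "symmetric_kernel r f \<longleftrightarrow>
     (\<forall>ts\<in>Delta r. \<forall>ks. \<forall>p. length ks = r \<longrightarrow> p permutes {..<r} \<longrightarrow>
        f (permute_list p ts) (permute_list p ks) = f ts ks)"

definition L2_kernel :: "nat \<Rightarrow> (nat list \<Rightarrow> 'd::finite list \<Rightarrow> real) \<Rightarrow> bool" where
  "L2_kernel r f \<longleftrightarrow> (\<lambda>ts. \<Sum>ks | length ks = r. (f ts ks)\<^sup>2) summable_on Delta r"

text \<open>The sum over the unordered index set \<open>Delta r\<close> is the limit in $L^2$ along the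
  net of its finite subsets.\<close>

definition multiple_integral ::
    "(nat \<Rightarrow> nat) measure \<Rightarrow> (nat \<Rightarrow> nat \<Rightarrow> (nat \<Rightarrow> nat) \<Rightarrow> real ^ 'd::finite) \<Rightarrow>
     nat \<Rightarrow> (nat list \<Rightarrow> 'd list \<Rightarrow> real) \<Rightarrow> (nat \<Rightarrow> nat) \<Rightarrow> real" where
  "multiple_integral P v r f w =
     (if r = 0 then f [] []
      else \<Sum>ks | length ks = r.
        L2_lim P (\<lambda>A w'. \<Sum>ts\<in>A. f ts ks * (\<Prod>l<r. walk v (ts ! l) w' $ (ks ! l)))
          (finite_subsets_at_top (Delta r)) w)"


subsection \<open>Gradient and divergence\<close>

text \<open>The kernel $f_r^j(*,k)\,1_{\Delta_r}(*,k)$.\<close>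

definition gradient_kernel ::
    "nat \<Rightarrow> 'd \<Rightarrow> (nat list \<Rightarrow> 'd list \<Rightarrow> real) \<Rightarrow> nat list \<Rightarrow> 'd list \<Rightarrow> real" where
  "gradient_kernel k j f ts ks = (if k \<in> set ts then 0 else f (ts @ [k]) (ks @ [j]))"

text \<open>The graph of $D_k^j$ on $\mathcal{S}$, the space of finite sums of multiple integrals
  of symmetric square-summable kernels; the term $r = 0$ contributes nothing to the
  gradient.\<close>

definition gradient_on_S ::
    "(nat \<Rightarrow> nat) measure \<Rightarrow> (nat \<Rightarrow> nat \<Rightarrow> (nat \<Rightarrow> nat) \<Rightarrow> real ^ 'd::finite) \<Rightarrow>
     nat \<Rightarrow> 'd \<Rightarrow> ((nat \<Rightarrow> nat) \<Rightarrow> real) \<Rightarrow> ((nat \<Rightarrow> nat) \<Rightarrow> real) \<Rightarrow> bool" where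
  "gradient_on_S P v k j F G \<longleftrightarrow>
     F \<in> L2_space P \<and> G \<in> L2_space P \<and>
     (\<exists>n f. (\<forall>r\<le>n. symmetric_kernel r (f r) \<and> L2_kernel r (f r)) \<and>
        (AE w in P. F w = (\<Sum>r\<le>n. multiple_integral P v r (f r) w)) \<and>
        (AE w in P. G w =
           (\<Sum>r=1..n. real r * multiple_integral P v (r - 1) (gradient_kernel k j (f r)) w)))"

text \<open>The extension of $D_k^j$ to $L^2$ by continuity: the value at \<open>F\<close> is the $L^2$-limit
  of the values along a sequence in $\mathcal{S}$ that converges to \<open>F\<close>.\<close>

definition has_gradient ::
    "(nat \<Rightarrow> nat) measure \<Rightarrow> (nat \<Rightarrow> nat \<Rightarrow> (nat \<Rightarrow> nat) \<Rightarrow> real ^ 'd::finite) \<Rightarrow>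
     nat \<Rightarrow> 'd \<Rightarrow> ((nat \<Rightarrow> nat) \<Rightarrow> real) \<Rightarrow> ((nat \<Rightarrow> nat) \<Rightarrow> real) \<Rightarrow> bool" where
  "has_gradient P v k j F G \<longleftrightarrow>
     (\<exists>Fs Gs. (\<forall>m. gradient_on_S P v k j (Fs m) (Gs m)) \<and>
        L2_tendsto P Fs F sequentially \<and> L2_tendsto P Gs G sequentially)"

definition gradient ::
    "(nat \<Rightarrow> nat) measure \<Rightarrow> (nat \<Rightarrow> nat \<Rightarrow> (nat \<Rightarrow> nat) \<Rightarrow> real ^ 'd::finite) \<Rightarrow>
     nat \<Rightarrow> ((nat \<Rightarrow> nat) \<Rightarrow> real) \<Rightarrow> (nat \<Rightarrow> nat) \<Rightarrow> real ^ 'd" where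
  "gradient P v k F w = (\<chi> j. (SOME G. has_gradient P v k j F G) w)"

definition divergence_correction ::
    "(nat \<Rightarrow> nat) measure \<Rightarrow> (nat \<Rightarrow> nat \<Rightarrow> (nat \<Rightarrow> nat) \<Rightarrow> real ^ 'd::finite) \<Rightarrow>
     (nat \<Rightarrow> (nat \<Rightarrow> nat) \<Rightarrow> real ^ 'd) \<Rightarrow> 'd \<Rightarrow> nat \<Rightarrow> (nat \<Rightarrow> nat) \<Rightarrow> real" where
  "divergence_correction P v X i k w =
     (gradient P v k (\<lambda>w'. X k w' $ i) w \<bullet> walk v k w) * walk v k w $ i"

definition divergence_domain ::
    "(nat \<Rightarrow> nat) measure \<Rightarrow> (nat \<Rightarrow> nat \<Rightarrow> (nat \<Rightarrow> nat) \<Rightarrow> real ^ 'd::finite) \<Rightarrow>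
     (nat \<Rightarrow> (nat \<Rightarrow> nat) \<Rightarrow> real ^ 'd) set" where
  "divergence_domain P v =
     {X. L2_process P X \<and> L2_summable P (\<lambda>k w. X k w \<bullet> walk v k w) \<and>
         (\<forall>i. L2_summable P (divergence_correction P v X i))}"

definition divergence ::
    "(nat \<Rightarrow> nat) measure \<Rightarrow> (nat \<Rightarrow> nat \<Rightarrow> (nat \<Rightarrow> nat) \<Rightarrow> real ^ 'd::finite) \<Rightarrow>
     (nat \<Rightarrow> (nat \<Rightarrow> nat) \<Rightarrow> real ^ 'd) \<Rightarrow> (nat \<Rightarrow> nat) \<Rightarrow> real" where
  "divergence P v X w =
     L2_suminf P (\<lambda>k w'. X k w' \<bullet> walk v k w') w
     - (\<Sum>i\<in>UNIV. L2_suminf P (divergence_correction P v X i) w)"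

end

theory Submission
  imports Defs "HOL-Combinatorics.Multiset_Permutations"
begin

text \<open>
  The correction terms in the divergence contain the gradient at time \<open>k\<close> of a random variable
  $F = X_k^i$ that is measurable with respect to the past of \<open>k\<close>.  This gradient is zero, and
  what remains of the divergence is the stochastic integral.

  The products \<open>chaos \<kappa>\<close> of components of the walk over distinct times, written $e_\kappa$
  here and indexed by finite partial maps \<open>\<kappa>\<close> from times to components, are orthonormal (\<open>chaos_orthonormal\<close>).  The
  gradient $D_k^j$ acts on them as an annihilation operator: it removes the factor $Y_k^j$ if it is
  present, and gives zero otherwise.  In adjoint form,
  $\langle D_k^j F, e_\kappa \rangle = \langle F, e_{\kappa(k \mapsto j)} \rangle$ if $k$ is not in the
  domain of $\kappa$ and $\langle D_k^j F, e_\kappa \rangle = 0$ otherwise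
  (\<open>has_gradient_inner_chaos\<close>).  If $F$ depends only on the past of $k$, then $F$ is orthogonal
  to every product that contains the time $k$, so $D_k^j F$ is orthogonal to all products and hence
  zero (\<open>has_gradient_past_unique\<close>).

  The gradient is defined through a choice, so it must also be shown that $D_k^j F$ exists.  Here
  the obtuse structure is used: conditionally on the past, the vectors $(1, v_i(n))$ for
  $0 \le i \le d$ are $d + 1$ vectors that satisfy orthonormality relations in dimension $d + 1$, so
  the indicator of a step is an affine function of $Y_n$ (\<open>AE_indicator_step\<close>).  By induction on
  time, every random variable that depends on the past of $k$ is a finite combination of products
  with times before $k$ (\<open>past_chaos_expansion\<close>).  It is therefore a finite sum of multiple
  integrals whose gradient kernels at time $k$ vanish identically
  (\<open>has_gradient_past_zero\<close>).

  All multiple integrals and the stochastic integral are $L^2$-limits; they exist because their terms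
  are almost orthogonal and square summable (\<open>L2_almost_orthogonal_converges\<close>), and inner products
  can then be computed term by term.
\<close>

section \<open>Limits in L2\<close>

lemma L2_spaceD:
  assumes "f \<in> L2_space M"
  shows "f \<in> borel_measurable M" "integrable M (\<lambda>w. (f w)\<^sup>2)"
  using assms by (auto simp: L2_space_def)

lemma L2_integrable_mult:
  assumes "f \<in> L2_space M" "g \<in> L2_space M"
  shows "integrable M (\<lambda>w. f w * g w)"
proof (rule Bochner_Integration.integrable_bound)
  show "integrable M (\<lambda>w. (f w)\<^sup>2 + (g w)\<^sup>2)"
    using assms by (auto dest: L2_spaceD)
  show "(\<lambda>w. f w * g w) \<in> borel_measurable M"
    using assms[THEN L2_spaceD(1)] by measurable
  have "\<bar>a * b\<bar> \<le> a\<^sup>2 + b\<^sup>2" for a b :: real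
  proof -
    have "2 * \<bar>a\<bar> * \<bar>b\<bar> \<le> a\<^sup>2 + b\<^sup>2" using sum_squares_bound[of "\<bar>a\<bar>" "\<bar>b\<bar>"] by simp
    moreover have "0 \<le> \<bar>a\<bar> * \<bar>b\<bar>" by simp
    ultimately show ?thesis unfolding abs_mult by linarith
  qed
  then show "AE w in M. norm (f w * g w) \<le> norm ((f w)\<^sup>2 + (g w)\<^sup>2)"
    by (intro AE_I2) simp
qed

lemma L2_space_add:
  assumes "f \<in> L2_space M" "g \<in> L2_space M"
  shows "(\<lambda>w. f w + g w) \<in> L2_space M"
  using assms L2_integrable_mult[OF assms]
  by (auto simp: L2_space_def power2_sum mult.assoc)

lemma L2_space_cmult:
  assumes "f \<in> L2_space M"
  shows "(\<lambda>w. c * f w) \<in> L2_space M"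
  using assms by (auto simp: L2_space_def power_mult_distrib)

lemma L2_space_diff:
  assumes "f \<in> L2_space M" "g \<in> L2_space M"
  shows "(\<lambda>w. f w - g w) \<in> L2_space M"
  using L2_space_add[OF assms(1) L2_space_cmult[OF assms(2), of "-1"]] by simp

lemma L2_space_zero: "(\<lambda>_. 0) \<in> L2_space M"
  by (simp add: L2_space_def)

lemma L2_space_sum:
  assumes "\<And>i. i \<in> A \<Longrightarrow> f i \<in> L2_space M"
  shows "(\<lambda>w. \<Sum>i\<in>A. f i w) \<in> L2_space M"
  using assms
  by (induction A rule: infinite_finite_induct) (auto intro: L2_space_zero L2_space_add)

lemma (in finite_measure) L2_space_bounded:
  assumes "f \<in> borel_measurable M" "\<And>w. w \<in> space M \<Longrightarrow> \<bar>f w\<bar> \<le> B"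
  shows "f \<in> L2_space M"
proof -
  have "integrable M (\<lambda>w. (f w)\<^sup>2)"
    using assms(1)
  proof (intro integrable_const_bound[where B = "B\<^sup>2"] AE_I2)
    fix w assume "w \<in> space M"
    from power_mono[OF assms(2)[OF this] abs_ge_zero, of 2]
    show "norm ((f w)\<^sup>2) \<le> B\<^sup>2" by simp
  qed simp
  with assms(1) show ?thesis by (simp add: L2_space_def)
qed

lemma L2_norm_zero_AE:
  assumes "f \<in> L2_space M" "(\<integral>w. (f w)\<^sup>2 \<partial>M) = 0"
  shows "AE w in M. f w = 0"
  using assms integral_nonneg_eq_0_iff_AE[of M "\<lambda>w. (f w)\<^sup>2"] by (auto dest: L2_spaceD)

lemma L2_Cauchy_Schwarz:
  assumes "f \<in> L2_space M" "g \<in> L2_space M"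
  shows "(\<integral>w. f w * g w \<partial>M)\<^sup>2 \<le> (\<integral>w. (f w)\<^sup>2 \<partial>M) * (\<integral>w. (g w)\<^sup>2 \<partial>M)"
proof (cases "(\<integral>w. (g w)\<^sup>2 \<partial>M) = 0")
  case True
  from L2_norm_zero_AE[OF assms(2) this]
  have "(\<integral>w. f w * g w \<partial>M) = (\<integral>w. 0 \<partial>M)"
    using L2_integrable_mult[OF assms] by (intro integral_cong_AE) auto
  then show ?thesis by simp
next
  case False
  let ?a = "\<integral>w. (f w)\<^sup>2 \<partial>M" and ?b = "\<integral>w. f w * g w \<partial>M" and ?c = "\<integral>w. (g w)\<^sup>2 \<partial>M"
  have c: "?c > 0" using False by (simp add: less_le)
  have "0 \<le> (\<integral>w. (?c * f w - ?b * g w)\<^sup>2 \<partial>M)" by simp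
  also have "\<dots> = (\<integral>w. ?c\<^sup>2 * (f w)\<^sup>2 - (2 * ?b * ?c) * (f w * g w) + ?b\<^sup>2 * (g w)\<^sup>2 \<partial>M)"
    by (intro Bochner_Integration.integral_cong) (auto simp: power2_eq_square algebra_simps)
  also have "\<dots> = ?c\<^sup>2 * ?a - (2 * ?b * ?c) * ?b + ?b\<^sup>2 * ?c"
    using L2_spaceD(2)[OF assms(1)] L2_spaceD(2)[OF assms(2)] L2_integrable_mult[OF assms]
    by simp
  also have "\<dots> = ?c * (?a * ?c - ?b\<^sup>2)" by (simp add: power2_eq_square algebra_simps)
  finally show ?thesis using c by (simp add: zero_le_mult_iff)
qed

text \<open>This is what makes the choices in \<open>L2_lim\<close> and \<open>L2_suminf\<close> harmless:
  whenever an $L^2$-limit exists, the chosen representative is almost everywhere the expected one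
  (\<open>L2_lim_AE_eq\<close> below).\<close>

lemma L2_tendsto_unique:
  assumes "L2_tendsto M u S F" "L2_tendsto M u S' F" "F \<noteq> bot"
  shows "AE w in M. S w = S' w"
proof -
  have S: "S \<in> L2_space M" "S' \<in> L2_space M" using assms by (auto simp: L2_tendsto_def)
  note SS = L2_space_diff[OF S]
  have "((\<lambda>x. 2 * (\<integral>w. (u x w - S w)\<^sup>2 \<partial>M) + 2 * (\<integral>w. (u x w - S' w)\<^sup>2 \<partial>M))
      \<longlongrightarrow> 2 * 0 + 2 * 0) F"
    using assms by (intro tendsto_intros) (auto simp: L2_tendsto_def)
  moreover have "\<forall>\<^sub>F x in F. (\<integral>w. (S w - S' w)\<^sup>2 \<partial>M)
      \<le> 2 * (\<integral>w. (u x w - S w)\<^sup>2 \<partial>M) + 2 * (\<integral>w. (u x w - S' w)\<^sup>2 \<partial>M)"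
  proof -
    have "\<forall>\<^sub>F x in F. u x \<in> L2_space M" using assms(1) by (simp add: L2_tendsto_def)
    then show ?thesis
    proof eventually_elim
      case (elim x)
      note i = L2_spaceD(2)[OF L2_space_diff[OF elim S(1)]]
        L2_spaceD(2)[OF L2_space_diff[OF elim S(2)]]
      have le: "(a - b)\<^sup>2 \<le> 2 * (c - a)\<^sup>2 + 2 * (c - b)\<^sup>2" for a b c :: real
        using zero_le_power2[of "2 * c - a - b"] by (simp add: power2_eq_square algebra_simps)
      have "(\<integral>w. (S w - S' w)\<^sup>2 \<partial>M) \<le> (\<integral>w. 2 * (u x w - S w)\<^sup>2 + 2 * (u x w - S' w)\<^sup>2 \<partial>M)"
        using i L2_spaceD(2)[OF SS] by (intro integral_mono) (auto intro: le)
      also have "\<dots> = 2 * (\<integral>w. (u x w - S w)\<^sup>2 \<partial>M) + 2 * (\<integral>w. (u x w - S' w)\<^sup>2 \<partial>M)"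
        using i by simp
      finally show ?case .
    qed
  qed
  ultimately have "(\<integral>w. (S w - S' w)\<^sup>2 \<partial>M) \<le> 2 * 0 + 2 * 0"
    using assms(3) by (intro tendsto_lowerbound)
  then have "(\<integral>w. (S w - S' w)\<^sup>2 \<partial>M) = 0" by (simp add: order_antisym)
  from L2_norm_zero_AE[OF SS this] show ?thesis by simp
qed

lemma L2_tendsto_L2_lim:
  assumes "L2_tendsto M u S F"
  shows "L2_tendsto M u (L2_lim M u F) F"
  unfolding L2_lim_def by (rule someI[of "\<lambda>S. L2_tendsto M u S F", OF assms])

lemma L2_lim_AE_eq:
  assumes "L2_tendsto M u S F" "F \<noteq> bot"
  shows "AE w in M. L2_lim M u F w = S w"
  by (rule L2_tendsto_unique[OF L2_tendsto_L2_lim[OF assms(1)] assms])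

lemma L2_tendsto_eventually_AE_eq:
  assumes "S \<in> L2_space M" "\<forall>\<^sub>F x in F. u x \<in> L2_space M \<and> (AE w in M. u x w = S w)"
  shows "L2_tendsto M u S F"
proof -
  have "\<forall>\<^sub>F x in F. (\<integral>w. (u x w - S w)\<^sup>2 \<partial>M) = 0"
    using assms(2)
  proof eventually_elim
    case (elim x)
    with L2_spaceD(2)[OF L2_space_diff[of "u x" M S]] assms(1)
    have "(\<integral>w. (u x w - S w)\<^sup>2 \<partial>M) = (\<integral>w. 0 \<partial>M)"
      by (intro integral_cong_AE) auto
    then show ?case by simp
  qed
  then have "((\<lambda>x. \<integral>w. (u x w - S w)\<^sup>2 \<partial>M) \<longlongrightarrow> 0) F"
    by (rule tendsto_eventually)
  with assms show ?thesis by (auto simp: L2_tendsto_def elim: eventually_mono)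
qed

lemma L2_tendsto_compose:
  assumes "L2_tendsto M u S F" "filterlim g F G"
  shows "L2_tendsto M (\<lambda>x. u (g x)) S G"
  using assms eventually_compose_filterlim[OF _ assms(2)] filterlim_compose[OF _ assms(2)]
  by (auto simp: L2_tendsto_def)

lemma L2_tendsto_integral_mult:
  assumes "L2_tendsto M u S F" "h \<in> L2_space M"
  shows "((\<lambda>x. \<integral>w. u x w * h w \<partial>M) \<longlongrightarrow> (\<integral>w. S w * h w \<partial>M)) F"
proof (rule LIM_zero_cancel, rule Lim_null_comparison)
  have S: "S \<in> L2_space M" and u: "\<forall>\<^sub>F x in F. u x \<in> L2_space M"
    using assms(1) by (auto simp: L2_tendsto_def)
  let ?c = "\<integral>w. (h w)\<^sup>2 \<partial>M"
  show "\<forall>\<^sub>F x in F. norm ((\<integral>w. u x w * h w \<partial>M) - (\<integral>w. S w * h w \<partial>M))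
      \<le> sqrt ((\<integral>w. (u x w - S w)\<^sup>2 \<partial>M) * ?c)"
    using u
  proof eventually_elim
    case (elim x)
    have "(\<integral>w. u x w * h w \<partial>M) - (\<integral>w. S w * h w \<partial>M) = (\<integral>w. (u x w - S w) * h w \<partial>M)"
      using L2_integrable_mult[OF elim assms(2)] L2_integrable_mult[OF S assms(2)]
      by (simp add: left_diff_distrib)
    then show ?case
      using L2_Cauchy_Schwarz[OF L2_space_diff[OF elim S] assms(2)]
      by (simp add: real_le_rsqrt)
  qed
  have "((\<lambda>x. sqrt ((\<integral>w. (u x w - S w)\<^sup>2 \<partial>M) * ?c)) \<longlongrightarrow> sqrt (0 * ?c)) F"
    using assms(1) by (intro tendsto_intros) (simp add: L2_tendsto_def)
  then show "((\<lambda>x. sqrt ((\<integral>w. (u x w - S w)\<^sup>2 \<partial>M) * ?c)) \<longlongrightarrow> 0) F" by simp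
qed

text \<open>The Riesz--Fischer argument for a sequence whose Cauchy modulus is geometric.  On a finite
  measure space the bound on the squared increments makes the absolute increments summable in
  $L^1$, so the sequence converges almost everywhere; Fatou's lemma then transfers the Cauchy
  bound to the distance from the limit.\<close>

lemma (in finite_measure) L2_complete:
  assumes u: "\<And>n. u n \<in> L2_space M"
    and cauchy: "\<And>n m. n \<le> m \<Longrightarrow> (\<integral>w. (u m w - u n w)\<^sup>2 \<partial>M) \<le> C * (1/4) ^ n"
  obtains S where "S \<in> L2_space M" "\<And>n. (\<integral>w. (u n w - S w)\<^sup>2 \<partial>M) \<le> C * (1/4) ^ n"
proof -
  have meas [measurable]: "u n \<in> borel_measurable M" for n using L2_spaceD(1)[OF u] .
  have C: "C \<ge> 0" using cauchy[of 0 0] by simp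
  define c where "c = measure M (space M) / 2 + C / 2"
  have c: "c \<ge> 0" unfolding c_def using C by simp
  have bound: "(\<integral>\<^sup>+w. ennreal \<bar>u (Suc n) w - u n w\<bar> \<partial>M) \<le> ennreal (c * (1/2) ^ n)" for n
  proof -
    let ?d = "\<lambda>w. u (Suc n) w - u n w"
    have i: "integrable M (\<lambda>w. (?d w)\<^sup>2)" by (rule L2_spaceD(2)[OF L2_space_diff[OF u u]])
    \<comment> \<open>the arithmetic-geometric mean inequality, weighted so that both terms decay
      like \<open>2\<^sup>-\<^sup>n\<close>\<close>
    have amgm: "\<bar>x\<bar> \<le> (1/2) ^ n / 2 + 2 ^ n / 2 * x\<^sup>2" for x :: real
    proof -
      define Z where "Z = 2 ^ n * x\<^sup>2 + (1/2) ^ n - 2 * \<bar>x\<bar>"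
      have "0 \<le> (2 ^ n * \<bar>x\<bar> - 1)\<^sup>2" by simp
      also have "\<dots> = 2 ^ n * Z"
        by (simp add: Z_def power2_eq_square algebra_simps power_one_over)
      finally have "0 \<le> 2 ^ n * Z" .
      then have "0 \<le> Z" by (rule contrapos_pp) (simp add: not_le mult_pos_neg)
      then show ?thesis by (simp add: Z_def)
    qed
    have "(\<integral>\<^sup>+w. ennreal \<bar>?d w\<bar> \<partial>M) \<le> (\<integral>\<^sup>+w. ennreal ((1/2) ^ n / 2 + 2 ^ n / 2 * (?d w)\<^sup>2) \<partial>M)"
      by (intro nn_integral_mono ennreal_leI amgm)
    also have "\<dots> = ennreal (\<integral>w. (1/2) ^ n / 2 + 2 ^ n / 2 * (?d w)\<^sup>2 \<partial>M)"
      using i by (intro nn_integral_eq_integral) auto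
    also have "(\<integral>w. (1/2) ^ n / 2 + 2 ^ n / 2 * (?d w)\<^sup>2 \<partial>M)
        = (1/2) ^ n / 2 * measure M (space M) + 2 ^ n / 2 * (\<integral>w. (?d w)\<^sup>2 \<partial>M)"
      using i by simp
    also have "\<dots> \<le> (1/2) ^ n / 2 * measure M (space M) + 2 ^ n / 2 * (C * (1/4) ^ n)"
      using cauchy[of n "Suc n"] by (intro add_mono mult_left_mono) auto
    also have "\<dots> = c * (1/2) ^ n"
    proof -
      have "(2::real) ^ n * (1/4) ^ n = (1/2) ^ n"
        by (simp add: power_mult_distrib[symmetric])
      then show ?thesis by (simp add: c_def algebra_simps)
    qed
    finally show ?thesis by (simp add: ennreal_leI)
  qed
  have "(\<integral>\<^sup>+w. (\<Sum>n. ennreal \<bar>u (Suc n) w - u n w\<bar>) \<partial>M)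
      = (\<Sum>n. \<integral>\<^sup>+w. ennreal \<bar>u (Suc n) w - u n w\<bar> \<partial>M)"
    by (intro nn_integral_suminf) auto
  also have "\<dots> \<le> (\<Sum>n. ennreal (c * (1/2) ^ n))"
    by (intro suminf_le bound) auto
  also have "\<dots> = ennreal (\<Sum>n. c * (1/2) ^ n)"
    using c by (intro suminf_ennreal2 summable_mult summable_geometric) auto
  finally have "(\<integral>\<^sup>+w. (\<Sum>n. ennreal \<bar>u (Suc n) w - u n w\<bar>) \<partial>M) \<noteq> \<infinity>"
    by (auto simp: top_unique)
  then have "AE w in M. (\<Sum>n. ennreal \<bar>u (Suc n) w - u n w\<bar>) \<noteq> \<infinity>"
    by (intro nn_integral_noteq_infinite) auto
  then have conv: "AE w in M. convergent (\<lambda>n. u n w)"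
  proof eventually_elim
    case (elim w)
    then have "summable (\<lambda>n. \<bar>u (Suc n) w - u n w\<bar>)"
      by (intro summable_suminf_not_top) auto
    then have "summable (\<lambda>n. u (Suc n) w - u n w)"
      by (rule summable_rabs_cancel)
    then have "convergent (\<lambda>n. (\<Sum>k<n. u (Suc k) w - u k w) + u 0 w)"
      by (intro convergent_add convergent_const) (simp add: summable_iff_convergent)
    moreover have "(\<Sum>k<n. u (Suc k) w - u k w) + u 0 w = u n w" for n
      by (simp add: sum_lessThan_telescope[of "\<lambda>n. u n w"])
    ultimately show ?case by simp
  qed
  define S where "S w = lim (\<lambda>n. u n w)" for w
  have S_meas [measurable]: "S \<in> borel_measurable M" unfolding S_def by simp
  have nn: "(\<integral>\<^sup>+w. ennreal ((u n w - S w)\<^sup>2) \<partial>M) \<le> ennreal (C * (1/4) ^ n)" for n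
  proof -
    have "(\<integral>\<^sup>+w. ennreal ((u n w - S w)\<^sup>2) \<partial>M)
        = (\<integral>\<^sup>+w. liminf (\<lambda>m. ennreal ((u n w - u m w)\<^sup>2)) \<partial>M)"
    proof (rule nn_integral_cong_AE, use conv in eventually_elim)
      case (elim w)
      then have "(\<lambda>m. u m w) \<longlonglongrightarrow> S w" unfolding S_def by (simp add: convergent_LIMSEQ_iff)
      then have "(\<lambda>m. ennreal ((u n w - u m w)\<^sup>2)) \<longlonglongrightarrow> ennreal ((u n w - S w)\<^sup>2)"
        by (intro tendsto_intros)
      from lim_imp_Liminf[OF _ this] show ?case by simp
    qed
    also have "\<dots> \<le> liminf (\<lambda>m. \<integral>\<^sup>+w. ennreal ((u n w - u m w)\<^sup>2) \<partial>M)"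
      by (intro nn_integral_liminf) auto
    also have "\<dots> \<le> limsup (\<lambda>m. \<integral>\<^sup>+w. ennreal ((u n w - u m w)\<^sup>2) \<partial>M)"
      by (intro Liminf_le_Limsup) simp
    also have "\<dots> \<le> ennreal (C * (1/4) ^ n)"
    proof (intro Limsup_bounded, use eventually_ge_at_top[of n] in eventually_elim)
      case (elim m)
      have "(\<integral>\<^sup>+w. ennreal ((u n w - u m w)\<^sup>2) \<partial>M) = ennreal (\<integral>w. (u n w - u m w)\<^sup>2 \<partial>M)"
        by (intro nn_integral_eq_integral L2_spaceD(2)[OF L2_space_diff[OF u u]]) auto
      also have "\<dots> \<le> ennreal (C * (1/4) ^ n)"
        using cauchy[OF elim] by (intro ennreal_leI) (simp add: power2_commute)
      finally show ?case .
    qed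
    finally show ?thesis .
  qed
  have int: "integrable M (\<lambda>w. (u n w - S w)\<^sup>2)" for n
    using le_less_trans[OF nn[of n] ennreal_less_top] by (intro integrableI_nonneg) auto
  have "(\<lambda>w. u 0 w - S w) \<in> L2_space M" using int[of 0] by (simp add: L2_space_def)
  from L2_space_diff[OF u[of 0] this] have "S \<in> L2_space M" by simp
  moreover have "(\<integral>w. (u n w - S w)\<^sup>2 \<partial>M) \<le> C * (1/4) ^ n" for n
  proof -
    have "ennreal (\<integral>w. (u n w - S w)\<^sup>2 \<partial>M) = (\<integral>\<^sup>+w. ennreal ((u n w - S w)\<^sup>2) \<partial>M)"
      using int by (intro nn_integral_eq_integral[symmetric]) auto
    with nn[of n] have "ennreal (\<integral>w. (u n w - S w)\<^sup>2 \<partial>M) \<le> ennreal (C * (1/4) ^ n)" by simp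
    then show ?thesis using C by (subst (asm) ennreal_le_iff) auto
  qed
  ultimately show thesis by (rule that)
qed

text \<open>Expand the square.  By the arithmetic-geometric mean inequality a nonzero inner product of
  \<open>x i\<close> and \<open>x j\<close> costs half of each squared norm, and each index takes part in at most
  \<open>N\<close> of them.  Plain orthogonality is \<open>N = 1\<close>.  The terms of a multiple integral need
  \<open>N = r!\<close>: a fixed list of upper indices may contain repetitions, and then permuted lists of
  times give the same product of the walk.\<close>

lemma L2_almost_orthogonal_norm_le:
  fixes x :: "'i \<Rightarrow> 'a \<Rightarrow> real"
  assumes "finite A" and x: "\<And>i. i \<in> A \<Longrightarrow> x i \<in> L2_space M"
    and N: "\<And>i. i \<in> A \<Longrightarrow> card {j \<in> A. (\<integral>w. x i w * x j w \<partial>M) \<noteq> 0} \<le> N"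
  shows "(\<integral>w. (\<Sum>i\<in>A. x i w)\<^sup>2 \<partial>M) \<le> N * (\<Sum>i\<in>A. \<integral>w. (x i w)\<^sup>2 \<partial>M)"
proof -
  let ?g = "\<lambda>i j. \<integral>w. x i w * x j w \<partial>M" and ?q = "\<lambda>i. \<integral>w. (x i w)\<^sup>2 \<partial>M"
  let ?z = "\<lambda>i j. if ?g i j \<noteq> 0 then 1 else 0 :: real"
  have sym: "?g i j = ?g j i" for i j by (simp add: mult.commute)
  have "(\<integral>w. (\<Sum>i\<in>A. x i w)\<^sup>2 \<partial>M) = (\<integral>w. (\<Sum>i\<in>A. \<Sum>j\<in>A. x i w * x j w) \<partial>M)"
    by (simp add: power2_eq_square sum_product)
  also have "\<dots> = (\<Sum>i\<in>A. \<integral>w. (\<Sum>j\<in>A. x i w * x j w) \<partial>M)"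
    by (intro Bochner_Integration.integral_sum Bochner_Integration.integrable_sum
        L2_integrable_mult x)
  also have "\<dots> = (\<Sum>i\<in>A. \<Sum>j\<in>A. ?g i j)"
    by (intro sum.cong refl Bochner_Integration.integral_sum L2_integrable_mult x)
  also have "\<dots> \<le> (\<Sum>i\<in>A. \<Sum>j\<in>A. (?q i * ?z i j) / 2 + (?q j * ?z i j) / 2)"
  proof (intro sum_mono)
    fix i j assume ij: "i \<in> A" "j \<in> A"
    show "?g i j \<le> (?q i * ?z i j) / 2 + (?q j * ?z i j) / 2"
    proof (cases "?g i j = 0")
      case False
      have le: "a * b \<le> a\<^sup>2 / 2 + b\<^sup>2 / 2" for a b :: real
        using sum_squares_bound[of a b] by simp
      have "?g i j \<le> (\<integral>w. (x i w)\<^sup>2 / 2 + (x j w)\<^sup>2 / 2 \<partial>M)"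
        using L2_spaceD(2)[OF x[OF ij(1)]] L2_spaceD(2)[OF x[OF ij(2)]]
        by (intro integral_mono L2_integrable_mult x ij le) auto
      also have "\<dots> = ?q i / 2 + ?q j / 2"
        using L2_spaceD(2)[OF x[OF ij(1)]] L2_spaceD(2)[OF x[OF ij(2)]] by simp
      finally show ?thesis using False by simp
    qed simp
  qed
  also have "\<dots> = (\<Sum>i\<in>A. \<Sum>j\<in>A. ?q i * ?z i j / 2) + (\<Sum>i\<in>A. \<Sum>j\<in>A. ?q j * ?z i j / 2)"
    by (simp add: sum.distrib)
  also have "(\<Sum>i\<in>A. \<Sum>j\<in>A. ?q j * ?z i j / 2) = (\<Sum>i\<in>A. \<Sum>j\<in>A. ?q i * ?z i j / 2)"
    by (subst sum.swap) (simp add: sym)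
  also have "(\<Sum>i\<in>A. \<Sum>j\<in>A. ?q i * ?z i j / 2) + (\<Sum>i\<in>A. \<Sum>j\<in>A. ?q i * ?z i j / 2)
      = (\<Sum>i\<in>A. ?q i * (\<Sum>j\<in>A. ?z i j))"
    by (simp add: sum.distrib[symmetric] sum_distrib_left)
  also have "\<dots> = (\<Sum>i\<in>A. ?q i * card {j \<in> A. ?g i j \<noteq> 0})"
    using assms(1) by (simp add: sum.If_cases Int_def)
  also have "\<dots> \<le> (\<Sum>i\<in>A. ?q i * N)"
    using N by (intro sum_mono mult_left_mono) auto
  also have "\<dots> = N * (\<Sum>i\<in>A. ?q i)" by (simp add: sum_distrib_left mult.commute)
  finally show ?thesis .
qed

text \<open>An almost orthogonal series with summable squared norms is Cauchy along the net of finite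
  index sets.  Completeness is applied to an increasing sequence of finite sets that exhausts the
  sum of the squared norms at geometric speed, and its limit attracts the whole net.\<close>

lemma (in finite_measure) L2_almost_orthogonal_converges:
  fixes x :: "'i \<Rightarrow> 'a \<Rightarrow> real"
  assumes x: "\<And>i. i \<in> I \<Longrightarrow> x i \<in> L2_space M"
    and N: "\<And>A i. finite A \<Longrightarrow> A \<subseteq> I \<Longrightarrow> i \<in> A \<Longrightarrow>
      card {j \<in> A. (\<integral>w. x i w * x j w \<partial>M) \<noteq> 0} \<le> N"
    and q: "(\<lambda>i. \<integral>w. (x i w)\<^sup>2 \<partial>M) summable_on I"
  shows "\<exists>S. L2_tendsto M (\<lambda>A w. \<Sum>i\<in>A. x i w) S (finite_subsets_at_top I)"
proof -
  let ?q = "\<lambda>i. \<integral>w. (x i w)\<^sup>2 \<partial>M"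
  obtain s where s: "(?q has_sum s) I" using q by (auto simp: summable_on_def)
  have small: "\<exists>A. finite A \<and> A \<subseteq> I \<and> (\<forall>B. finite B \<longrightarrow> B \<subseteq> I - A \<longrightarrow> sum ?q B \<le> (1/4) ^ n)" for n
  proof -
    obtain A where A: "finite A" "A \<subseteq> I" "dist (sum ?q A) s \<le> (1/4) ^ n"
      using has_sum_finite_approximation[OF s, of "(1/4) ^ n"] by auto
    have "sum ?q B \<le> (1/4) ^ n" if B: "finite B" "B \<subseteq> I - A" for B
    proof -
      have "sum ?q A + sum ?q B = sum ?q (A \<union> B)"
        using A B by (intro sum.union_disjoint[symmetric]) auto
      also have "\<dots> \<le> s"
        using A B s by (intro finite_sum_le_has_sum) auto
      finally show ?thesis using A(3) by (simp add: dist_real_def)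
    qed
    with A show ?thesis by blast
  qed
  define T where "T n = (SOME A. finite A \<and> A \<subseteq> I
    \<and> (\<forall>B. finite B \<longrightarrow> B \<subseteq> I - A \<longrightarrow> sum ?q B \<le> (1/4) ^ n))" for n
  have T: "finite (T n)" "T n \<subseteq> I" "\<And>B. finite B \<Longrightarrow> B \<subseteq> I - T n \<Longrightarrow> sum ?q B \<le> (1/4) ^ n" for n
    using someI_ex[OF small[of n]] unfolding T_def by blast+
  define V where "V n = (\<Union>k\<le>n. T k)" for n
  have V: "finite (V n)" "V n \<subseteq> I" "T n \<subseteq> V n" for n
    using T by (auto simp: V_def)
  have V_mono: "V n \<subseteq> V m" if "n \<le> m" for n m
    using that unfolding V_def by (intro UN_mono) auto
  have L2: "(\<lambda>w. \<Sum>i\<in>A. x i w) \<in> L2_space M" if "A \<subseteq> I" for A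
    using that by (intro L2_space_sum x) auto
  have diff: "(\<integral>w. ((\<Sum>i\<in>A. x i w) - (\<Sum>i\<in>V n. x i w))\<^sup>2 \<partial>M) \<le> real N * (1/4) ^ n"
    if A: "finite A" "A \<subseteq> I" "V n \<subseteq> A" for A n
  proof -
    have "(\<Sum>i\<in>A. x i w) - (\<Sum>i\<in>V n. x i w) = (\<Sum>i\<in>A - V n. x i w)" for w
      using A by (simp add: sum_diff)
    then have "(\<integral>w. ((\<Sum>i\<in>A. x i w) - (\<Sum>i\<in>V n. x i w))\<^sup>2 \<partial>M)
        = (\<integral>w. (\<Sum>i\<in>A - V n. x i w)\<^sup>2 \<partial>M)" by simp
    also have "\<dots> \<le> N * sum ?q (A - V n)"
      using A by (intro L2_almost_orthogonal_norm_le x N) auto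
    also have "\<dots> \<le> N * (1/4) ^ n"
      using A V(3)[of n] by (intro mult_left_mono T(3)) auto
    finally show ?thesis .
  qed
  obtain S where S: "S \<in> L2_space M"
    "\<And>n. (\<integral>w. ((\<Sum>i\<in>V n. x i w) - S w)\<^sup>2 \<partial>M) \<le> real N * (1/4) ^ n"
    by (rule L2_complete[of "\<lambda>n w. \<Sum>i\<in>V n. x i w" "real N",
        OF L2[OF V(2)] diff[OF V(1) V(2) V_mono]]) blast+
  have close: "(\<integral>w. ((\<Sum>i\<in>A. x i w) - S w)\<^sup>2 \<partial>M) \<le> 4 * real N * (1/4) ^ n"
    if A: "finite A" "A \<subseteq> I" "V n \<subseteq> A" for A n
  proof -
    note i = L2_spaceD(2)[OF L2_space_diff[OF L2[OF A(2)] L2[OF V(2)]]]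
      L2_spaceD(2)[OF L2_space_diff[OF L2[OF V(2)] S(1)]]
    have le: "(a - b)\<^sup>2 \<le> 2 * (a - c)\<^sup>2 + 2 * (c - b)\<^sup>2" for a b c :: real
      using zero_le_power2[of "2 * c - a - b"] by (simp add: power2_eq_square algebra_simps)
    have "(\<integral>w. ((\<Sum>i\<in>A. x i w) - S w)\<^sup>2 \<partial>M)
      \<le> (\<integral>w. 2 * ((\<Sum>i\<in>A. x i w) - (\<Sum>i\<in>V n. x i w))\<^sup>2 + 2 * ((\<Sum>i\<in>V n. x i w) - S w)\<^sup>2 \<partial>M)"
      using i L2_spaceD(2)[OF L2_space_diff[OF L2[OF A(2)] S(1)]]
      by (intro integral_mono) (auto intro: le)
    also have "\<dots> = 2 * (\<integral>w. ((\<Sum>i\<in>A. x i w) - (\<Sum>i\<in>V n. x i w))\<^sup>2 \<partial>M)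
        + 2 * (\<integral>w. ((\<Sum>i\<in>V n. x i w) - S w)\<^sup>2 \<partial>M)"
      using i by simp
    also have "\<dots> \<le> 2 * (real N * (1/4) ^ n) + 2 * (real N * (1/4) ^ n)"
      using diff[OF A] S(2)[of n] by (intro add_mono mult_left_mono) auto
    finally show ?thesis by simp
  qed
  have "((\<lambda>A. \<integral>w. ((\<Sum>i\<in>A. x i w) - S w)\<^sup>2 \<partial>M) \<longlongrightarrow> 0) (finite_subsets_at_top I)"
  proof (rule tendstoI)
    fix e :: real assume "e > 0"
    have "(\<lambda>n. 4 * real N * (1/4) ^ n) \<longlonglongrightarrow> 4 * real N * 0"
      by (intro tendsto_intros LIMSEQ_power_zero) simp
    then have "(\<lambda>n. 4 * real N * (1/4) ^ n) \<longlonglongrightarrow> 0" by simp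
    from order_tendstoD(2)[OF this \<open>e > 0\<close>]
    obtain n where n: "4 * real N * (1/4) ^ n < e" by (auto simp: eventually_sequentially)
    show "\<forall>\<^sub>F A in finite_subsets_at_top I. dist (\<integral>w. ((\<Sum>i\<in>A. x i w) - S w)\<^sup>2 \<partial>M) 0 < e"
      unfolding eventually_finite_subsets_at_top
    proof (intro exI[of _ "V n"] conjI allI impI)
      fix A assume "finite A \<and> V n \<subseteq> A \<and> A \<subseteq> I"
      then have "(\<integral>w. ((\<Sum>i\<in>A. x i w) - S w)\<^sup>2 \<partial>M) < e"
        using close[of A n] n by auto
      then show "dist (\<integral>w. ((\<Sum>i\<in>A. x i w) - S w)\<^sup>2 \<partial>M) 0 < e"
        by simp
    qed (use V[of n] in auto)
  qed
  moreover have "\<forall>\<^sub>F A in finite_subsets_at_top I. (\<lambda>w. \<Sum>i\<in>A. x i w) \<in> L2_space M"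
    using L2 by (intro eventually_finite_subsets_at_top_weakI) auto
  ultimately show ?thesis using S(1) unfolding L2_tendsto_def by blast
qed

section \<open>The filtration of the path space\<close>

lemma borel_measurable_vec_nth_comp:
  fixes f :: "'a \<Rightarrow> real ^ 'd::finite"
  assumes "f \<in> borel_measurable M"
  shows "(\<lambda>w. f w $ i) \<in> borel_measurable M"
  using assms borel_measurable_nth[of i] by (rule measurable_compose)

lemma space_past: "space (past d n) = space (path_space d)"
  unfolding past_def sigma_generated_def by (rule space_measure_of) auto

lemma sets_past: "sets (past d n) = sigma_sets (space (path_space d))
    (\<Union>m\<in>{..<n}. {(\<lambda>w. w m) -` A \<inter> space (path_space d) | A. A \<in> sets (count_space {0..d})})"
  unfolding past_def sigma_generated_def by (rule sets_measure_of) auto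

lemma path_le: "w \<in> space (path_space d) \<Longrightarrow> w m \<le> d"
  by (auto simp: path_space_def space_PiM PiE_def)

lemma path_update: "w \<in> space (path_space d) \<Longrightarrow> i \<le> d \<Longrightarrow> w(n := i) \<in> space (path_space d)"
  by (auto simp: path_space_def space_PiM PiE_def)

lemma coordinate_measurable_past:
  assumes "m < n"
  shows "(\<lambda>w. w m) \<in> measurable (past d n) (count_space {0..d})"
proof (rule measurableI)
  fix A assume "A \<in> sets (count_space {0..d})"
  then show "(\<lambda>w. w m) -` A \<inter> space (past d n) \<in> sets (past d n)"
    unfolding space_past sets_past using assms by (intro sigma_sets.Basic) auto
qed (auto simp: space_past path_le)

lemma measurable_into_past:
  assumes "f \<in> space N \<rightarrow> space (path_space d)"
    and "\<And>m. m < n \<Longrightarrow> (\<lambda>x. f x m) \<in> measurable N (count_space {0..d})"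
  shows "f \<in> measurable N (past d n)"
  unfolding past_def sigma_generated_def
proof (rule measurable_measure_of)
  fix B assume "B \<in> (\<Union>m\<in>{..<n}. {(\<lambda>w. w m) -` A \<inter> space (path_space d) |A.
      A \<in> sets (count_space {0..d})})"
  then obtain m A where m: "m < n" "A \<in> sets (count_space {0..d})"
    and B: "B = (\<lambda>w. w m) -` A \<inter> space (path_space d)" by auto
  have "f -` B \<inter> space N = (\<lambda>x. f x m) -` A \<inter> space N" using assms(1) B by auto
  then show "f -` B \<inter> space N \<in> sets N" using measurable_sets[OF assms(2)] m by auto
qed (use assms in auto)

lemma measurable_past_mono:
  assumes "f \<in> measurable (past d m) N" "m \<le> n"
  shows "f \<in> measurable (past d n) N"
proof -
  have "(\<lambda>w. w) \<in> measurable (past d n) (past d m)"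
    using assms(2) by (intro measurable_into_past coordinate_measurable_past) (auto simp: space_past)
  from measurable_compose[OF this assms(1)] show ?thesis .
qed

text \<open>Freezing the present coordinate turns a function of the past and the present into a function
  of the past.  Together with $F(w) = F(w(n := w_n))$ this is the form in which the finiteness of
  the alphabet enters every induction on time.\<close>

lemma measurable_past_fix_coordinate:
  assumes "f \<in> measurable (past d (Suc n)) N" "i \<le> d"
  shows "(\<lambda>w. f (w(n := i))) \<in> measurable (past d n) N"
proof -
  have "(\<lambda>w. w(n := i)) \<in> measurable (past d n) (past d (Suc n))"
  proof (rule measurable_into_past)
    fix m assume "m < Suc n"
    show "(\<lambda>w. (w(n := i)) m) \<in> measurable (past d n) (count_space {0..d})"
    proof (cases "m = n")
      case False
      with \<open>m < Suc n\<close> have "m < n" by simp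
      from coordinate_measurable_past[OF this] False show ?thesis by simp
    qed (use assms(2) in simp)
  qed (use assms(2) in \<open>auto simp: space_past intro!: path_update\<close>)
  from measurable_compose[OF this assms(1)] show ?thesis .
qed

lemma measurable_past_0_constant:
  fixes F :: "(nat \<Rightarrow> nat) \<Rightarrow> real"
  assumes "F \<in> borel_measurable (past d 0)" "w \<in> space (path_space d)" "w' \<in> space (path_space d)"
  shows "F w = F w'"
proof -
  have "F -` {F w} \<inter> space (past d 0) \<in> sets (past d 0)"
    using assms(1) by (rule measurable_sets) simp
  also have "sets (past d 0) = {{}, space (path_space d)}"
    by (simp add: sets_past sigma_sets_empty_eq)
  finally have "F -` {F w} \<inter> space (path_space d) = space (path_space d)"
    using assms(2) by (auto simp: space_past)
  then have "w' \<in> F -` {F w}" using assms(3) by blast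
  then show ?thesis by simp
qed

text \<open>The coordinates take finitely many values, so a function of finitely many of them is
  bounded.\<close>

lemma measurable_past_bounded:
  fixes F :: "(nat \<Rightarrow> nat) \<Rightarrow> real"
  assumes "F \<in> borel_measurable (past d n)"
  shows "\<exists>B. \<forall>w\<in>space (path_space d). \<bar>F w\<bar> \<le> B"
  using assms
proof (induction n arbitrary: F)
  case 0
  then show ?case using measurable_past_0_constant[of F d] by (metis order_refl)
next
  case (Suc n)
  have "\<forall>i\<in>{..d}. \<exists>B. \<forall>w\<in>space (path_space d). \<bar>F (w(n := i))\<bar> \<le> B"
    using Suc.IH[OF measurable_past_fix_coordinate[OF Suc.prems]] by (metis atMost_iff)
  then obtain B where B: "\<And>i w. i \<le> d \<Longrightarrow> w \<in> space (path_space d) \<Longrightarrow> \<bar>F (w(n := i))\<bar> \<le> B i"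
    unfolding bchoice_iff by auto
  show ?case
  proof (intro exI ballI)
    fix w assume w: "w \<in> space (path_space d)"
    have "\<bar>F w\<bar> = \<bar>F (w(n := w n))\<bar>" by simp
    also have "\<dots> \<le> \<bar>B (w n)\<bar>" using B[OF path_le[OF w, of n] w] by linarith
    also have "\<dots> \<le> (\<Sum>i\<le>d. \<bar>B i\<bar>)"
      using path_le[OF w, of n] by (intro member_le_sum) auto
    finally show "\<bar>F w\<bar> \<le> (\<Sum>i\<le>d. \<bar>B i\<bar>)" .
  qed
qed

section \<open>Finite partial index maps\<close>

text \<open>A product $Y_{i_1}^{k_1} \cdots Y_{i_r}^{k_r}$ over distinct times depends only on the finite
  partial map $i_l \mapsto k_l$.  Such maps, rather than pairs of lists up to simultaneous
  permutation, index the products.\<close>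

definition maps_below :: "nat \<Rightarrow> (nat \<Rightarrow> 'd option) set" where
  "maps_below n = {\<kappa>. dom \<kappa> \<subseteq> {..<n}}"

lemma finite_maps_below: "finite (maps_below n :: (nat \<Rightarrow> 'd::finite option) set)"
proof -
  have "maps_below n = (\<Union>A\<in>Pow {..<n}. {\<kappa> :: nat \<Rightarrow> 'd option. dom \<kappa> = A \<and> ran \<kappa> \<subseteq> UNIV})"
    by (auto simp: maps_below_def)
  moreover have "finite {\<kappa> :: nat \<Rightarrow> 'd option. dom \<kappa> = A \<and> ran \<kappa> \<subseteq> UNIV}" if "A \<in> Pow {..<n}" for A
    using that by (intro finite_set_of_finite_maps) (auto intro: finite_subset)
  ultimately show ?thesis by simp
qed

lemma maps_below_0: "maps_below 0 = {Map.empty}"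
  by (auto simp: maps_below_def)

lemma sum_UNIV_option: "(\<Sum>x\<in>UNIV. g x) = g None + (\<Sum>j\<in>UNIV. g (Some j))"
  for g :: "'d::finite option \<Rightarrow> real"
  by (simp add: UNIV_option_conv sum.reindex)

lemma sum_maps_below_Suc:
  fixes g :: "(nat \<Rightarrow> 'd::finite option) \<Rightarrow> real"
  shows "(\<Sum>\<kappa>\<in>maps_below (Suc n). g \<kappa>)
    = (\<Sum>\<kappa>\<in>maps_below n. g \<kappa>) + (\<Sum>j\<in>UNIV. \<Sum>\<kappa>\<in>maps_below n. g (\<kappa>(n \<mapsto> j)))"
proof -
  have not_in: "\<kappa>(n := None) = \<kappa>" if "\<kappa> \<in> maps_below n" for \<kappa> :: "nat \<Rightarrow> 'd option"
    using that unfolding maps_below_def by (intro fun_upd_idem) blast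
  have up: "\<kappa>(n := x) \<in> maps_below (Suc n)" if "\<kappa> \<in> maps_below n" for \<kappa> and x :: "'d option"
    using that by (fastforce simp: maps_below_def split: if_splits)
  have down: "\<kappa>(n := None) \<in> maps_below n"
    if "\<kappa> \<in> maps_below (Suc n)" for \<kappa> :: "nat \<Rightarrow> 'd option"
    using that by (fastforce simp: maps_below_def less_Suc_eq)
  have "(\<Sum>\<kappa>\<in>maps_below (Suc n). g \<kappa>) = (\<Sum>(\<kappa>, x)\<in>maps_below n \<times> UNIV. g (\<kappa>(n := x)))"
    by (rule sum.reindex_bij_witness[of _ "\<lambda>(\<kappa>, x). \<kappa>(n := x)" "\<lambda>\<kappa>. (\<kappa>(n := None), \<kappa> n)"])
      (auto simp only: up down not_in split_beta fst_conv snd_conv mem_Times_iff fun_upd_upd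
        fun_upd_same fun_upd_triv UNIV_I prod.collapse)
  also have "\<dots> = (\<Sum>\<kappa>\<in>maps_below n. \<Sum>x\<in>UNIV. g (\<kappa>(n := x)))"
    by (simp add: sum.cartesian_product)
  also have "\<dots> = (\<Sum>\<kappa>\<in>maps_below n. g \<kappa> + (\<Sum>j\<in>UNIV. g (\<kappa>(n \<mapsto> j))))"
    unfolding sum_UNIV_option by (intro sum.cong refl) (simp add: not_in)
  also have "\<dots> = (\<Sum>\<kappa>\<in>maps_below n. g \<kappa>) + (\<Sum>\<kappa>\<in>maps_below n. \<Sum>j\<in>UNIV. g (\<kappa>(n \<mapsto> j)))"
    by (rule sum.distrib)
  also have "(\<Sum>\<kappa>\<in>maps_below n. \<Sum>j\<in>UNIV. g (\<kappa>(n \<mapsto> j)))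
      = (\<Sum>j\<in>UNIV. \<Sum>\<kappa>\<in>maps_below n. g (\<kappa>(n \<mapsto> j)))"
    by (rule sum.swap)
  finally show ?thesis .
qed

section \<open>Orthogonality relations of the walk\<close>

text \<open>The hypotheses say that the vectors $(1, u_i)$, weighted by $p_i$, satisfy $A B = 1$ for a pair
  of square matrices of size $d + 1$: the rows of $A$ are the components $0, \dots, d$ and its
  columns are the points $0, \dots, d$.  The conclusion is $B A = 1$.  It is the obtuse angle
  relation $\langle u_i, u_m \rangle = -1$ for $i \ne m$ wherever $p_i \ne 0$.\<close>

lemma obtuse_system_dual:
  fixes p :: "nat \<Rightarrow> real" and u :: "nat \<Rightarrow> real ^ 'd::finite"
  assumes one: "(\<Sum>i\<le>CARD('d). p i) = 1"
    and mean: "\<And>j. (\<Sum>i\<le>CARD('d). u i $ j * p i) = 0"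
    and cov: "\<And>j l. (\<Sum>i\<le>CARD('d). (u i $ j * u i $ l) * p i) = (if j = l then 1 else 0)"
    and "i \<le> CARD('d)" "m \<le> CARD('d)"
  shows "p i * (1 + u i \<bullet> u m) = (if i = m then 1 else 0)"
proof -
  have "card {..CARD('d)} = CARD('d option)" by (simp add: card_UNIV_option)
  then obtain h :: "'d option \<Rightarrow> nat" where h: "bij_betw h UNIV {..CARD('d)}"
    by (metis finite_same_card_bij finite_atMost finite)
  \<comment> \<open>the index \<open>None\<close> stands for the constant component 1 of $(1, u_i)$\<close>
  define t where "t i c = (case c of None \<Rightarrow> 1 | Some j \<Rightarrow> u i $ j)" for i and c :: "'d option"
  define A :: "real ^ 'd option ^ 'd option" where "A = (\<chi> c x. p (h x) * t (h x) c)"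
  define B :: "real ^ 'd option ^ 'd option" where "B = (\<chi> x c. t (h x) c)"
  have mean': "(\<Sum>i\<le>CARD('d). p i * u i $ j) = 0" for j
    using mean[of j] by (simp only: mult.commute)
  have cov': "(\<Sum>i\<le>CARD('d). p i * u i $ j * u i $ l) = (if j = l then 1 else 0)" for j l
    using cov[of j l] by (simp only: mult.assoc mult.commute[of "p _"])
  have "A ** B = mat 1"
  proof -
    have "(A ** B) $ c $ c' = mat 1 $ c $ c'" for c c'
    proof -
      have "(A ** B) $ c $ c' = (\<Sum>x\<in>UNIV. p (h x) * t (h x) c * t (h x) c')"
        by (simp add: matrix_matrix_mult_def A_def B_def)
      also have "\<dots> = (\<Sum>i\<le>CARD('d). p i * t i c * t i c')"
        by (rule sum.reindex_bij_betw[OF h, of "\<lambda>i. p i * t i c * t i c'"])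
      also have "\<dots> = mat 1 $ c $ c'"
        by (cases c; cases c') (simp_all add: t_def mat_def one mean' cov')
      finally show ?thesis .
    qed
    then show ?thesis by (simp add: vec_eq_iff)
  qed
  then have BA: "B ** A = mat 1" by (rule matrix_left_right_inverse1)
  obtain x y where xy: "h x = m" "h y = i"
    using h assms(4,5) by (metis atMost_iff bij_betw_iff_bijections)
  have "(B ** A) $ x $ y = (\<Sum>c\<in>UNIV. t m c * (p i * t i c))"
    by (simp add: matrix_matrix_mult_def A_def B_def xy)
  also have "\<dots> = p i * (1 + u i \<bullet> u m)"
    by (simp add: sum_UNIV_option t_def inner_vec_def sum_distrib_left algebra_simps)
  finally have "p i * (1 + u i \<bullet> u m) = (if x = y then 1 else 0)"
    unfolding BA by (simp add: mat_def)
  moreover have "x = y \<longleftrightarrow> i = m" using xy h by (auto simp: bij_betw_def inj_on_def)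
  ultimately show ?thesis by simp
qed

abbreviation step_prob ::
    "(nat \<Rightarrow> nat) measure \<Rightarrow> nat \<Rightarrow> nat \<Rightarrow> nat \<Rightarrow> (nat \<Rightarrow> nat) \<Rightarrow> real" where
  "step_prob M d n i \<equiv> real_cond_exp M (past d n) (indicator {w \<in> space M. w n = i})"

context obtuse_random_walk
begin

lemma space_P: "space P = space (path_space CARD('d))"
  by (rule sets_eq_imp_space_eq[OF sets_P])

lemma subalgebra_past: "subalgebra P (past CARD('d) n)"
proof -
  have "(\<lambda>w. w) \<in> measurable P (past CARD('d) n)"
  proof (rule measurable_into_past)
    have "(\<lambda>w. w m) \<in> measurable (path_space CARD('d)) (count_space {0..CARD('d)})" for m
      unfolding path_space_def by measurable
    then show "(\<lambda>w. w m) \<in> measurable P (count_space {0..CARD('d)})" for m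
      by (simp add: measurable_cong_sets[OF sets_P refl])
  qed (simp add: space_P)
  from measurable_sets[OF this]
  show ?thesis
    unfolding subalgebra_def
    using sets.sets_into_space[of _ "past CARD('d) n"]
    by (auto simp: space_past space_P Int_absorb2)
qed

lemma past_cond_exp: "sigma_finite_subalgebra P (past CARD('d) n)"
  by (intro finite_measure_subalgebra_is_sigma_finite)
    (simp add: finite_measure_subalgebra_def finite_measure_subalgebra_axioms_def
      subalgebra_past finite_measure_axioms)

lemma past_borel: "F \<in> borel_measurable (past CARD('d) n) \<Longrightarrow> F \<in> borel_measurable P"
  by (rule measurable_from_subalg[OF subalgebra_past])

lemma past_L2:
  fixes F :: "(nat \<Rightarrow> nat) \<Rightarrow> real"
  assumes "F \<in> borel_measurable (past CARD('d) n)"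
  shows "F \<in> L2_space P"
proof -
  obtain B where "\<forall>w\<in>space (path_space CARD('d)). \<bar>F w\<bar> \<le> B"
    using measurable_past_bounded[OF assms] by blast
  then show ?thesis by (intro L2_space_bounded[of F B] past_borel[OF assms]) (auto simp: space_P)
qed

lemma past_integrable:
  fixes F :: "(nat \<Rightarrow> nat) \<Rightarrow> real"
  assumes "F \<in> borel_measurable (past CARD('d) n)"
  shows "integrable P F"
  using L2_integrable_mult[OF past_L2[OF assms] past_L2[of "\<lambda>_. 1" 0]] by simp

lemma walk_measurable_past:
  assumes "m < n"
  shows "(\<lambda>w. walk v m w $ i) \<in> borel_measurable (past CARD('d) n)"
proof -
  have "(\<lambda>w. v (w m) m w) \<in> borel_measurable (past CARD('d) n)"
  proof (rule measurable_compose_countable'[where I = "{0..CARD('d)}" and f = "\<lambda>i w. v i m w"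
        and g = "\<lambda>w. w m"])
    fix i assume "i \<in> {0..CARD('d)}"
    then show "v i m \<in> borel_measurable (past CARD('d) n)"
      using assms by (intro measurable_past_mono[OF v_measurable[of i m]]) auto
  qed (use assms in \<open>auto intro: coordinate_measurable_past\<close>)
  then have "(\<lambda>w. walk v m w) \<in> borel_measurable (past CARD('d) n)"
    by (simp add: walk_def)
  then show ?thesis by (rule borel_measurable_vec_nth_comp)
qed

lemma integral_past_times_walk:
  assumes H: "H \<in> borel_measurable (past CARD('d) n)"
  shows "(\<integral>w. H w * walk v n w $ i \<partial>P) = 0"
proof -
  interpret sigma_finite_subalgebra P "past CARD('d) n" by (rule past_cond_exp)
  note Y = walk_measurable_past[of n "Suc n", OF lessI]
  have "(\<integral>w. H w * walk v n w $ i \<partial>P)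
      = (\<integral>w. H w * real_cond_exp P (past CARD('d) n) (\<lambda>w. walk v n w $ i) w \<partial>P)"
    by (intro real_cond_exp_intg(2)[symmetric] H past_borel[OF Y]
        L2_integrable_mult past_L2[OF H] past_L2[OF Y])
  also have "\<dots> = (\<integral>w. 0 \<partial>P)"
  proof (rule integral_cong_AE)
    show "AE w in P. H w * real_cond_exp P (past CARD('d) n) (\<lambda>w. walk v n w $ i) w = 0"
      using cond_mean[of n i] by eventually_elim simp
  qed (use past_borel[OF H] in measurable)
  finally show ?thesis by simp
qed

lemma integral_past_times_walk_walk:
  assumes H: "H \<in> borel_measurable (past CARD('d) n)"
  shows "(\<integral>w. H w * (walk v n w $ i * walk v n w $ j) \<partial>P) = (if i = j then \<integral>w. H w \<partial>P else 0)"
proof -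
  interpret sigma_finite_subalgebra P "past CARD('d) n" by (rule past_cond_exp)
  have Y: "(\<lambda>w. walk v n w $ i * walk v n w $ j) \<in> borel_measurable (past CARD('d) (Suc n))"
    by (intro borel_measurable_times walk_measurable_past) auto
  have "(\<integral>w. H w * (walk v n w $ i * walk v n w $ j) \<partial>P)
      = (\<integral>w. H w * real_cond_exp P (past CARD('d) n) (\<lambda>w. walk v n w $ i * walk v n w $ j) w \<partial>P)"
    by (intro real_cond_exp_intg(2)[symmetric] H past_borel[OF Y]
        L2_integrable_mult past_L2[OF H] past_L2[OF Y])
  also have "\<dots> = (\<integral>w. H w * (if i = j then 1 else 0) \<partial>P)"
  proof (rule integral_cong_AE)
    show "AE w in P. H w * real_cond_exp P (past CARD('d) n) (\<lambda>w. walk v n w $ i * walk v n w $ j) w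
        = H w * (if i = j then 1 else 0)"
      using cond_cov[of n i j] by eventually_elim simp
  qed (use past_borel[OF H] in measurable)
  finally show ?thesis by simp
qed

section \<open>The chaos basis\<close>

definition chaos :: "(nat \<Rightarrow> 'd option) \<Rightarrow> (nat \<Rightarrow> nat) \<Rightarrow> real" where
  "chaos \<kappa> w = (\<Prod>n\<in>dom \<kappa>. walk v n w $ the (\<kappa> n))"

lemma chaos_empty: "chaos Map.empty w = 1"
  by (simp add: chaos_def)

lemma chaos_measurable_past:
  assumes "dom \<kappa> \<subseteq> {..<n}"
  shows "chaos \<kappa> \<in> borel_measurable (past CARD('d) n)"
proof -
  have "(\<lambda>w. \<Prod>n\<in>dom \<kappa>. walk v n w $ the (\<kappa> n)) \<in> borel_measurable (past CARD('d) n)"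
    using assms by (intro borel_measurable_prod walk_measurable_past) auto
  then show ?thesis by (simp add: chaos_def[abs_def])
qed

lemma finite_dom_below:
  fixes \<kappa> :: "nat \<Rightarrow> 'd option"
  assumes "finite (dom \<kappa>)"
  obtains n where "dom \<kappa> \<subseteq> {..<n}"
  using assms that by (auto simp: finite_nat_iff_bounded)

lemma chaos_L2:
  assumes "finite (dom \<kappa>)"
  shows "chaos \<kappa> \<in> L2_space P"
proof -
  obtain n where "dom \<kappa> \<subseteq> {..<n}" by (rule finite_dom_below[OF assms])
  then show ?thesis by (intro past_L2 chaos_measurable_past)
qed

lemma chaos_split_at:
  assumes "finite (dom \<kappa>)"
  shows "chaos \<kappa> w = chaos (\<kappa>(n := None)) w * (case \<kappa> n of None \<Rightarrow> 1 | Some j \<Rightarrow> walk v n w $ j)"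
proof (cases "\<kappa> n")
  case None
  then show ?thesis by (simp add: fun_upd_idem)
next
  case (Some j)
  have "chaos \<kappa> w = walk v n w $ j * (\<Prod>m\<in>dom \<kappa> - {n}. walk v m w $ the (\<kappa> m))"
    unfolding chaos_def using assms Some by (subst prod.remove[of _ n]) auto
  also have "(\<Prod>m\<in>dom \<kappa> - {n}. walk v m w $ the (\<kappa> m)) = chaos (\<kappa>(n := None)) w"
    unfolding chaos_def by (intro prod.cong) auto
  finally show ?thesis by (simp add: Some)
qed

lemma chaos_upd:
  assumes "finite (dom \<kappa>)" "n \<notin> dom \<kappa>"
  shows "chaos (\<kappa>(n \<mapsto> j)) w = chaos \<kappa> w * walk v n w $ j"
  using chaos_split_at[of "\<kappa>(n \<mapsto> j)" w n] assms by (simp add: fun_upd_idem domIff)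

text \<open>Induction on a bound for the times.  If the last time occurs in only one of the two products,
  the conditional mean of the walk is zero; if it occurs in both, the conditional covariance is
  the identity and the factor can be removed.\<close>

lemma chaos_orthonormal:
  assumes "finite (dom \<kappa>)" "finite (dom \<kappa>')"
  shows "(\<integral>w. chaos \<kappa> w * chaos \<kappa>' w \<partial>P) = (if \<kappa> = \<kappa>' then 1 else 0)"
proof -
  obtain n where "dom \<kappa> \<subseteq> {..<n}" "dom \<kappa>' \<subseteq> {..<n}"
    by (rule finite_dom_below[of "\<kappa> ++ \<kappa>'"]) (use assms in auto)
  then show ?thesis
  proof (induction n arbitrary: \<kappa> \<kappa>')
    case 0
    then have "\<kappa> = Map.empty" "\<kappa>' = Map.empty" by auto
    then show ?case by (simp add: chaos_empty prob_space)
  next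
    case (Suc n)
    define \<rho> where "\<rho> = \<kappa>(n := None)"
    define \<rho>' where "\<rho>' = \<kappa>'(n := None)"
    have sub: "dom \<rho> \<subseteq> {..<n}" "dom \<rho>' \<subseteq> {..<n}"
      using Suc.prems by (auto simp: \<rho>_def \<rho>'_def less_Suc_eq split: if_splits)
    note meas = chaos_measurable_past[OF sub(1)] chaos_measurable_past[OF sub(2)]
    have iff: "\<kappa> = \<kappa>' \<longleftrightarrow> \<rho> = \<rho>' \<and> \<kappa> n = \<kappa>' n"
      unfolding \<rho>_def \<rho>'_def by (metis fun_upd_triv fun_upd_upd)
    have fin: "finite (dom \<kappa>)" "finite (dom \<kappa>')"
      using Suc.prems by (auto intro: finite_subset)
    note split = chaos_split_at[OF fin(1), of _ n, folded \<rho>_def]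
      chaos_split_at[OF fin(2), of _ n, folded \<rho>'_def]
    show ?case
    proof (cases "\<kappa> n"; cases "\<kappa>' n")
      assume "\<kappa> n = None" "\<kappa>' n = None"
      with Suc.IH[OF sub] iff show ?thesis by (simp add: split)
    next
      fix j assume j: "\<kappa> n = None" "\<kappa>' n = Some j"
      have "chaos \<kappa> w * chaos \<kappa>' w = (chaos \<rho> w * chaos \<rho>' w) * walk v n w $ j" for w
        by (simp add: split j)
      with integral_past_times_walk[OF borel_measurable_times[OF meas], of j] iff j
      show ?thesis by simp
    next
      fix j assume j: "\<kappa> n = Some j" "\<kappa>' n = None"
      have "chaos \<kappa> w * chaos \<kappa>' w = (chaos \<rho> w * chaos \<rho>' w) * walk v n w $ j" for w
        by (simp add: split j)
      with integral_past_times_walk[OF borel_measurable_times[OF meas], of j] iff j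
      show ?thesis by simp
    next
      fix j l assume j: "\<kappa> n = Some j" "\<kappa>' n = Some l"
      have "chaos \<kappa> w * chaos \<kappa>' w
          = (chaos \<rho> w * chaos \<rho>' w) * (walk v n w $ j * walk v n w $ l)" for w
        by (simp add: split j)
      with integral_past_times_walk_walk[OF borel_measurable_times[OF meas], of j l]
        Suc.IH[OF sub] iff j
      show ?thesis by (cases "\<rho> = \<rho>'"; cases "j = l") simp_all
    qed
  qed
qed

text \<open>The argument is applied at the largest time of the product, which is at least \<open>k\<close>: all
  other factors, including \<open>F\<close>, are known before that time, and the walk has conditional mean
  zero.\<close>

lemma integral_past_times_chaos:
  assumes F: "F \<in> borel_measurable (past CARD('d) k)"
    and "finite (dom \<kappa>)" "k \<in> dom \<kappa>"
  shows "(\<integral>w. F w * chaos \<kappa> w \<partial>P) = 0"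
proof -
  define n where "n = Max (dom \<kappa>)"
  have n: "n \<in> dom \<kappa>" "k \<le> n" "\<And>m. m \<in> dom \<kappa> \<Longrightarrow> m \<le> n"
    unfolding n_def using Max_in[OF assms(2)] Max_ge[OF assms(2)] assms(3) by blast+
  then obtain j where j: "\<kappa> n = Some j" by auto
  define \<rho> where "\<rho> = \<kappa>(n := None)"
  have sub: "dom \<rho> \<subseteq> {..<n}" using n(3) by (fastforce simp: \<rho>_def split: if_splits)
  have eq: "(\<lambda>w. F w * chaos \<kappa> w) = (\<lambda>w. (F w * chaos \<rho> w) * walk v n w $ j)"
    using chaos_split_at[OF assms(2), of _ n] j by (simp add: \<rho>_def mult.assoc)
  have "(\<lambda>w. F w * chaos \<rho> w) \<in> borel_measurable (past CARD('d) n)"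
    by (intro borel_measurable_times measurable_past_mono[OF F n(2)] chaos_measurable_past sub)
  then show ?thesis unfolding eq by (rule integral_past_times_walk)
qed

text \<open>Given the past, the walk takes the value $v_i(n)$ with the conditional probability of the step
  \<open>i\<close>, so the moment conditions are the hypotheses of \<open>obtuse_system_dual\<close> at almost
  every point.  Its conclusion, read at the step that is actually taken, writes the indicator of a
  step as an affine function of the walk with coefficients that depend on the past.\<close>

lemma AE_indicator_step:
  "AE w in P. \<forall>i\<le>CARD('d).
    (if w n = i then 1 else 0) = step_prob P CARD('d) n i w * (1 + v i n w \<bullet> walk v n w)"
proof -
  interpret sigma_finite_subalgebra P "past CARD('d) n" by (rule past_cond_exp)
  let ?D = "CARD('d)"
  let ?ind = "\<lambda>i. indicator {w \<in> space P. w n = i} :: (nat \<Rightarrow> nat) \<Rightarrow> real"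
  have coord: "{w \<in> space P. w n = i} \<in> sets (past ?D (Suc n))" if "i \<le> ?D" for i
  proof -
    have "(\<lambda>w. w n) -` {i} \<inter> space (past ?D (Suc n)) \<in> sets (past ?D (Suc n))"
      using that by (intro measurable_sets[OF coordinate_measurable_past]) auto
    also have "(\<lambda>w. w n) -` {i} \<inter> space (past ?D (Suc n)) = {w \<in> space P. w n = i}"
      by (auto simp: space_past space_P)
    finally show ?thesis .
  qed
  have ind: "?ind i \<in> borel_measurable (past ?D (Suc n))" if "i \<le> ?D" for i
    using coord[OF that] by simp
  \<comment> \<open>conditional expectation of a function of the past and of the coordinate \<open>n\<close>\<close>
  have ce: "AE w in P. real_cond_exp P (past ?D n) (\<lambda>w. h (w n) w) w
      = (\<Sum>i\<le>?D. h i w * step_prob P CARD('d) n i w)"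
    if h: "\<And>i. i \<le> ?D \<Longrightarrow> h i \<in> borel_measurable (past ?D n)"
    for h :: "nat \<Rightarrow> (nat \<Rightarrow> nat) \<Rightarrow> real"
  proof -
    define g where "g i w = (if i \<le> ?D then h i w * ?ind i w else 0)" for i w
    have g: "g i \<in> borel_measurable (past ?D (Suc n))" for i
      using h[of i] ind[of i] measurable_past_mono[OF h[of i], of "Suc n"]
      by (cases "i \<le> ?D") (auto simp: g_def[abs_def])
    have gi: "integrable P (g i)" for i by (rule past_integrable[OF g])
    have decomp: "h (w n) w = (\<Sum>i\<le>?D. g i w)" if "w \<in> space P" for w
    proof -
      have "(\<Sum>i\<le>?D. g i w) = (\<Sum>i\<le>?D. if i = w n then h i w else 0)"
        using that by (intro sum.cong) (auto simp: g_def)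
      also have "\<dots> = h (w n) w" using path_le[of w ?D n] that by (simp add: space_P)
      finally show ?thesis by simp
    qed
    have sum_meas: "(\<lambda>w. \<Sum>i\<le>?D. g i w) \<in> borel_measurable P"
      by (intro borel_measurable_sum past_borel[OF g])
    have "AE w in P. real_cond_exp P (past ?D n) (\<lambda>w. h (w n) w) w
        = real_cond_exp P (past ?D n) (\<lambda>w. \<Sum>i\<le>?D. g i w) w"
    proof (rule real_cond_exp_cong[OF AE_I2 _ sum_meas])
      show "(\<lambda>w. h (w n) w) \<in> borel_measurable P"
        using sum_meas by (simp add: decomp cong: measurable_cong)
    qed (rule decomp)
    moreover have "AE w in P. real_cond_exp P (past ?D n) (\<lambda>w. \<Sum>i\<le>?D. g i w) w
        = (\<Sum>i\<le>?D. real_cond_exp P (past ?D n) (g i) w)"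
      by (rule real_cond_exp_sum[OF gi])
    moreover have "AE w in P. \<forall>i\<in>{..?D}. real_cond_exp P (past ?D n) (g i) w = h i w * step_prob P CARD('d) n i w"
    proof (intro AE_finite_allI)
      fix i assume i: "i \<in> {..?D}"
      have "g i = (\<lambda>w. h i w * ?ind i w)" using i by (auto simp: g_def)
      with real_cond_exp_mult[OF h past_borel[OF ind], of i i] gi[of i] i
      show "AE w in P. real_cond_exp P (past ?D n) (g i) w = h i w * step_prob P CARD('d) n i w" by simp
    qed simp
    ultimately show ?thesis by eventually_elim simp
  qed
  have v: "(\<lambda>w. v i n w $ j) \<in> borel_measurable (past ?D n)" if "i \<le> ?D" for i j
    using v_measurable[OF that, of n] by (rule borel_measurable_vec_nth_comp)
  have "AE w in P. (\<Sum>i\<le>?D. 1 * step_prob P CARD('d) n i w) = 1"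
    using ce[of "\<lambda>_ _. 1"] real_cond_exp_F_meas[of "\<lambda>_. 1"] by fastforce
  moreover have "AE w in P. \<forall>j. (\<Sum>i\<le>?D. v i n w $ j * step_prob P CARD('d) n i w) = 0"
  proof (subst AE_all_countable, rule allI)
    fix j
    have "AE w in P. real_cond_exp P (past ?D n) (\<lambda>w. v (w n) n w $ j) w
        = (\<Sum>i\<le>?D. v i n w $ j * step_prob P CARD('d) n i w)"
      by (rule ce) (rule v)
    from this cond_mean[of n j]
    show "AE w in P. (\<Sum>i\<le>?D. v i n w $ j * step_prob P CARD('d) n i w) = 0"
      by eventually_elim (simp add: walk_def)
  qed
  moreover have "AE w in P. \<forall>j l. (\<Sum>i\<le>?D. (v i n w $ j * v i n w $ l) * step_prob P CARD('d) n i w)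
      = (if j = l then 1 else 0)"
  proof (subst AE_all_countable, rule allI, subst AE_all_countable, rule allI)
    fix j l
    have "AE w in P. real_cond_exp P (past ?D n) (\<lambda>w. v (w n) n w $ j * v (w n) n w $ l) w
        = (\<Sum>i\<le>?D. (v i n w $ j * v i n w $ l) * step_prob P CARD('d) n i w)"
      by (rule ce) (intro borel_measurable_times v)
    from this cond_cov[of n j l]
    show "AE w in P. (\<Sum>i\<le>?D. (v i n w $ j * v i n w $ l) * step_prob P CARD('d) n i w) = (if j = l then 1 else 0)"
      by eventually_elim (simp add: walk_def)
  qed
  ultimately show ?thesis using AE_space
  proof eventually_elim
    case (elim w)
    then have "w n \<le> ?D" by (simp add: space_P path_le)
    show ?case
    proof (intro allI impI)
      fix i assume i: "i \<le> ?D"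
      from obtuse_system_dual[of "\<lambda>i. step_prob P CARD('d) n i w" "\<lambda>i. v i n w", OF _ _ _ i \<open>w n \<le> ?D\<close>] elim
      show "(if w n = i then 1 else 0) = step_prob P CARD('d) n i w * (1 + v i n w \<bullet> walk v n w)"
        by (simp add: walk_def eq_commute[of i])
    qed
  qed
qed

text \<open>Predictable representation in finite time.  Write $F(w)$ as the sum of $F(w(n := i))$ times the
  indicator of the step $i$, replace the indicators by affine functions of $Y_n$, and expand the
  coefficients, which depend on an earlier past.\<close>

lemma past_chaos_expansion:
  assumes "F \<in> borel_measurable (past CARD('d) n)"
  shows "\<exists>c. AE w in P. F w = (\<Sum>\<kappa>\<in>maps_below n. c \<kappa> * chaos \<kappa> w)"
  using assms
proof (induction n arbitrary: F)
  case 0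
  obtain w0 where "w0 \<in> space P" using not_empty by blast
  then have "F w = F w0 * chaos Map.empty w" if "w \<in> space P" for w
    using measurable_past_0_constant[OF 0, of w w0] that by (simp add: space_P chaos_empty)
  then show ?case by (intro exI[of _ "\<lambda>_. F w0"] AE_I2) (simp add: maps_below_0)
next
  case (Suc n)
  let ?D = "CARD('d)"
  have F: "(\<lambda>w. F (w(n := i))) \<in> borel_measurable (past ?D n)" if "i \<le> ?D" for i
    by (rule measurable_past_fix_coordinate[OF Suc.prems that])
  have v: "(\<lambda>w. v i n w $ j) \<in> borel_measurable (past ?D n)" if "i \<le> ?D" for i j
    using v_measurable[OF that, of n] by (rule borel_measurable_vec_nth_comp)
  define A0 where "A0 w = (\<Sum>i\<le>?D. F (w(n := i)) * step_prob P CARD('d) n i w)" for w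
  define A where "A j w = (\<Sum>i\<le>?D. F (w(n := i)) * step_prob P CARD('d) n i w * v i n w $ j)" for j w
  have "A0 \<in> borel_measurable (past ?D n)"
    unfolding A0_def[abs_def]
    by (intro borel_measurable_sum borel_measurable_times F borel_measurable_cond_exp) auto
  from Suc.IH[OF this] obtain c0
    where c0: "AE w in P. A0 w = (\<Sum>\<kappa>\<in>maps_below n. c0 \<kappa> * chaos \<kappa> w)" by blast
  have "A j \<in> borel_measurable (past ?D n)" for j
    unfolding A_def[abs_def]
    by (intro borel_measurable_sum borel_measurable_times F v borel_measurable_cond_exp) auto
  from Suc.IH[OF this] obtain c
    where "\<And>j. AE w in P. A j w = (\<Sum>\<kappa>\<in>maps_below n. c j \<kappa> * chaos \<kappa> w)" by metis
  then have c: "AE w in P. \<forall>j. A j w = (\<Sum>\<kappa>\<in>maps_below n. c j \<kappa> * chaos \<kappa> w)"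
    by (simp add: AE_all_countable)
  define c' where "c' \<kappa> = (case \<kappa> n of None \<Rightarrow> c0 \<kappa> | Some j \<Rightarrow> c j (\<kappa>(n := None)))" for \<kappa>
  have "AE w in P. F w = (\<Sum>\<kappa>\<in>maps_below (Suc n). c' \<kappa> * chaos \<kappa> w)"
    using AE_indicator_step[of n] c0 c AE_space
  proof eventually_elim
    case (elim w)
    then have wn: "w n \<le> ?D" by (simp add: space_P path_le)
    have "F w = (\<Sum>i\<le>?D. F (w(n := i)) * (if w n = i then 1 else 0))"
      using wn by (simp add: if_distrib[of "\<lambda>x. _ * x"] cong: if_cong)
    also have "\<dots> = (\<Sum>i\<le>?D. F (w(n := i)) * (step_prob P CARD('d) n i w * (1 + v i n w \<bullet> walk v n w)))"
      using elim(1) by (intro sum.cong) auto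
    also have "\<dots> = A0 w + (\<Sum>j\<in>UNIV. A j w * walk v n w $ j)"
    proof -
      have "(\<Sum>j\<in>UNIV. A j w * walk v n w $ j)
          = (\<Sum>i\<le>?D. \<Sum>j\<in>UNIV. F (w(n := i)) * step_prob P CARD('d) n i w * v i n w $ j * walk v n w $ j)"
        unfolding A_def sum_distrib_right by (rule sum.swap)
      also have "\<dots> = (\<Sum>i\<le>?D. F (w(n := i)) * step_prob P CARD('d) n i w * (v i n w \<bullet> walk v n w))"
        by (simp add: inner_vec_def sum_distrib_left mult.assoc)
      finally show ?thesis by (simp add: A0_def sum.distrib[symmetric] algebra_simps)
    qed
    also have "A0 w = (\<Sum>\<kappa>\<in>maps_below n. c' \<kappa> * chaos \<kappa> w)"
      unfolding elim(2)
      by (intro sum.cong refl) (auto simp: c'_def maps_below_def split: option.split)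
    also have "(\<Sum>j\<in>UNIV. A j w * walk v n w $ j)
        = (\<Sum>j\<in>UNIV. \<Sum>\<kappa>\<in>maps_below n. c' (\<kappa>(n \<mapsto> j)) * chaos (\<kappa>(n \<mapsto> j)) w)"
    proof (intro sum.cong refl)
      fix j
      have "c' (\<kappa>(n \<mapsto> j)) * chaos (\<kappa>(n \<mapsto> j)) w = c j \<kappa> * chaos \<kappa> w * walk v n w $ j"
        if "\<kappa> \<in> maps_below n" for \<kappa>
      proof -
        have n: "n \<notin> dom \<kappa>" "finite (dom \<kappa>)"
          using that by (auto simp: maps_below_def intro: finite_subset)
        then have "\<kappa>(n := None) = \<kappa>" by (auto simp: fun_upd_idem domIff)
        with chaos_upd[OF n(2,1)] show ?thesis by (simp add: c'_def)
      qed
      then show "A j w * walk v n w $ j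
          = (\<Sum>\<kappa>\<in>maps_below n. c' (\<kappa>(n \<mapsto> j)) * chaos (\<kappa>(n \<mapsto> j)) w)"
        using elim(3) by (simp add: sum_distrib_right)
    qed
    finally show ?case by (simp add: sum_maps_below_Suc)
  qed
  then show ?case by blast
qed

end

section \<open>Index lists and partial maps\<close>

lemma finite_lists_of_length: "finite {ks :: 'd::finite list. length ks = r}"
  using finite_lists_length_eq[of "UNIV :: 'd set" r] by simp

lemma Delta_D:
  assumes "ts \<in> Delta r"
  shows "length ts = r" "distinct ts"
  using assms by (simp_all add: Delta_def)

lemma dom_map_of_zip_Delta:
  assumes "ts \<in> Delta r" "length ks = r"
  shows "dom (map_of (zip ts ks)) = set ts"
  using assms by (simp add: Delta_D)

lemma map_of_zip_eq_iff:
  assumes "ts \<in> Delta r" "length ks = r"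
  shows "map_of (zip ts ks) = \<kappa> \<longleftrightarrow> set ts = dom \<kappa> \<and> ks = map (\<lambda>n. the (\<kappa> n)) ts"
proof
  assume eq: "map_of (zip ts ks) = \<kappa>"
  have "ks ! l = the (\<kappa> (ts ! l))" if "l < r" for l
    using that assms map_of_zip_nth[of ts ks l] unfolding eq[symmetric] by (simp add: Delta_D)
  then have "ks = map (\<lambda>n. the (\<kappa> n)) ts"
    using assms by (intro nth_equalityI) (auto simp: Delta_D)
  moreover have "dom \<kappa> = set ts" using dom_map_of_zip_Delta[OF assms] unfolding eq .
  ultimately show "set ts = dom \<kappa> \<and> ks = map (\<lambda>n. the (\<kappa> n)) ts" by simp
next
  assume r: "set ts = dom \<kappa> \<and> ks = map (\<lambda>n. the (\<kappa> n)) ts"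
  have "map_of (zip ts (map (\<lambda>n. the (\<kappa> n)) ts)) n = \<kappa> n" for n
    using r by (cases "\<kappa> n") (auto simp: map_of_zip_map domIff)
  then show "map_of (zip ts ks) = \<kappa>" using r by auto
qed

lemma Delta_with_set:
  assumes "finite A"
  shows "{ts \<in> Delta r. set ts = A} = (if card A = r then permutations_of_set A else {})"
  using distinct_card by (auto simp: Delta_def permutations_of_set_def)

text \<open>Two enumerations of the same set of times differ by a permutation, which moves the labels along
  with the times.\<close>

lemma symmetric_kernel_map_eq:
  assumes sym: "symmetric_kernel r f" and ts: "ts \<in> Delta r" "ts' \<in> Delta r" "set ts = set ts'"
  shows "f ts (map g ts) = f ts' (map g ts')"
proof -
  have "mset ts' = mset ts" using ts by (simp add: Delta_D set_eq_iff_mset_eq_distinct)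
  then obtain p where p: "p permutes {..<length ts}" "permute_list p ts = ts'"
    by (rule mset_eq_permutation)
  have "f (permute_list p ts) (permute_list p (map g ts)) = f ts (map g ts)"
    using sym ts(1) p(1) by (auto simp: symmetric_kernel_def Delta_D)
  then show ?thesis using p by (simp add: permute_list_map)
qed

text \<open>The nonzero values of the gradient kernel are values of \<open>f\<close> at pairwise different arguments, so its
  square sum is part of the square sum of \<open>f\<close>.\<close>

lemma L2_kernel_gradient_kernel:
  assumes "L2_kernel (Suc r) f"
  shows "L2_kernel r (gradient_kernel k j f)"
proof -
  let ?A = "{ts \<in> Delta r. k \<notin> set ts}" and ?h = "\<lambda>ts. ts @ [k]"
  let ?s = "\<lambda>ts. \<Sum>ks | length ks = Suc r. (f ts ks)\<^sup>2"
  have inj: "inj_on ?h ?A" by (auto simp: inj_on_def)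
  have "?s summable_on ?h ` ?A"
    by (rule summable_on_subset_banach[OF assms[unfolded L2_kernel_def]]) (auto simp: Delta_def)
  then have "(?s \<circ> ?h) summable_on ?A" by (simp only: summable_on_reindex[OF inj])
  then have "(\<lambda>ts. \<Sum>ks | length ks = r. (gradient_kernel k j f ts ks)\<^sup>2) summable_on ?A"
  proof (rule summable_on_comparison_test)
    fix ts assume ts: "ts \<in> ?A"
    have "(\<Sum>ks | length ks = r. (gradient_kernel k j f ts ks)\<^sup>2)
        = (\<Sum>ks | length ks = r. (f (ts @ [k]) (ks @ [j]))\<^sup>2)"
      using ts by (simp add: gradient_kernel_def)
    also have "\<dots> = (\<Sum>ks\<in>(\<lambda>ks. ks @ [j]) ` {ks. length ks = r}. (f (ts @ [k]) ks)\<^sup>2)"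
      by (subst sum.reindex) (auto simp: inj_on_def)
    also have "\<dots> \<le> (?s \<circ> ?h) ts"
      unfolding comp_def by (intro sum_mono2 finite_lists_of_length) auto
    finally show "(\<Sum>ks | length ks = r. (gradient_kernel k j f ts ks)\<^sup>2) \<le> (?s \<circ> ?h) ts" .
  qed (simp add: sum_nonneg)
  also have "?this \<longleftrightarrow> L2_kernel r (gradient_kernel k j f)"
    unfolding L2_kernel_def by (intro summable_on_cong_neutral) (auto simp: gradient_kernel_def)
  finally show ?thesis .
qed

text \<open>This is the coefficient of the multiple integral of \<open>f\<close> along \<open>chaos \<kappa>\<close>, see
  \<open>multiple_integral_inner_chaos\<close>.  It sums over all orderings of the times of \<open>\<kappa>\<close>.\<close>

definition kernel_coefficient ::
    "nat \<Rightarrow> (nat list \<Rightarrow> 'd list \<Rightarrow> real) \<Rightarrow> (nat \<Rightarrow> 'd option) \<Rightarrow> real" where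
  "kernel_coefficient r f \<kappa> = (\<Sum>ts | ts \<in> Delta r \<and> set ts = dom \<kappa>. f ts (map (\<lambda>n. the (\<kappa> n)) ts))"

text \<open>For a symmetric kernel all orderings of the times contribute the same value, so both sides are
  a factorial times this value, and $(r + 1) \cdot r! = (r + 1)!$.  This is where the factor $r$ in
  the definition of the gradient comes from.\<close>

lemma kernel_coefficient_gradient:
  assumes sym: "symmetric_kernel (Suc r) f" and fin: "finite (dom \<kappa>)"
  shows "real (Suc r) * kernel_coefficient r (gradient_kernel k j f) \<kappa>
    = (if k \<in> dom \<kappa> then 0 else kernel_coefficient (Suc r) f (\<kappa>(k \<mapsto> j)))"
proof (cases "k \<notin> dom \<kappa> \<and> card (dom \<kappa>) = r")
  case False
  then have "kernel_coefficient r (gradient_kernel k j f) \<kappa> = 0"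
    unfolding kernel_coefficient_def Delta_with_set[OF fin]
    by (cases "k \<in> dom \<kappa>") (auto intro!: sum.neutral simp: gradient_kernel_def permutations_of_set_def)
  moreover have "kernel_coefficient (Suc r) f (\<kappa>(k \<mapsto> j)) = 0" if "k \<notin> dom \<kappa>"
  proof -
    have "finite (dom (\<kappa>(k \<mapsto> j)))" "card (dom (\<kappa>(k \<mapsto> j))) \<noteq> Suc r"
      using fin that False by auto
    then show ?thesis unfolding kernel_coefficient_def by (subst Delta_with_set) auto
  qed
  ultimately show ?thesis by simp
next
  case True
  let ?\<kappa> = "\<kappa>(k \<mapsto> j)"
  let ?g = "\<lambda>n. the (?\<kappa> n)"
  have fin': "finite (dom ?\<kappa>)" and card': "card (dom ?\<kappa>) = Suc r" using fin True by auto
  obtain ts0 where ts0: "set ts0 = dom ?\<kappa>" "distinct ts0"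
    using finite_distinct_list[OF fin'] by blast
  have ts0_D: "ts0 \<in> Delta (Suc r)"
    using ts0 card' distinct_card[of ts0] by (simp add: Delta_def)
  let ?C = "f ts0 (map ?g ts0)"
  have "kernel_coefficient (Suc r) f ?\<kappa> = (\<Sum>ts | ts \<in> Delta (Suc r) \<and> set ts = dom ?\<kappa>. ?C)"
    unfolding kernel_coefficient_def using ts0 ts0_D
    by (intro sum.cong refl symmetric_kernel_map_eq[OF sym]) auto
  also have "\<dots> = fact (Suc r) * ?C"
    unfolding Delta_with_set[OF fin'] using fin' card' by (simp del: fact_Suc dom_fun_upd)
  finally have 1: "kernel_coefficient (Suc r) f ?\<kappa> = fact (Suc r) * ?C" .
  have "kernel_coefficient r (gradient_kernel k j f) \<kappa>
      = (\<Sum>ts | ts \<in> Delta r \<and> set ts = dom \<kappa>. ?C)"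
    unfolding kernel_coefficient_def
  proof (intro sum.cong refl)
    fix ts assume "ts \<in> {ts. ts \<in> Delta r \<and> set ts = dom \<kappa>}"
    then have ts: "ts \<in> Delta r" "set ts = dom \<kappa>" by auto
    then have k: "k \<notin> set ts" using True by simp
    have "map (\<lambda>n. the (\<kappa> n)) ts @ [j] = map ?g (ts @ [k])" using k by auto
    then have "gradient_kernel k j f ts (map (\<lambda>n. the (\<kappa> n)) ts) = f (ts @ [k]) (map ?g (ts @ [k]))"
      using k by (simp only: gradient_kernel_def if_False)
    also have "\<dots> = ?C"
      using ts k ts0 ts0_D by (intro symmetric_kernel_map_eq[OF sym]) (auto simp: Delta_def)
    finally show "gradient_kernel k j f ts (map (\<lambda>n. the (\<kappa> n)) ts) = ?C" .
  qed
  also have "\<dots> = fact r * ?C"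
    unfolding Delta_with_set[OF fin] using fin True by simp
  finally show ?thesis using True 1 by (simp add: mult.assoc)
qed

context obtuse_random_walk
begin

section \<open>Multiple integrals\<close>

lemma prod_walk_eq_chaos:
  assumes "ts \<in> Delta r" "length ks = r"
  shows "(\<Prod>l<r. walk v (ts ! l) w $ (ks ! l)) = chaos (map_of (zip ts ks)) w"
proof -
  have "(\<Prod>l<r. walk v (ts ! l) w $ (ks ! l))
      = (\<Prod>l<r. walk v (ts ! l) w $ the (map_of (zip ts ks) (ts ! l)))"
    using assms by (intro prod.cong) (auto simp: Delta_D map_of_zip_nth)
  also have "\<dots> = (\<Prod>n\<in>set ts. walk v n w $ the (map_of (zip ts ks) n))"
    using assms by (intro prod.reindex_bij_betw[of "\<lambda>l. ts ! l"] bij_betw_nth) (auto simp: Delta_D)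
  finally show ?thesis by (simp add: chaos_def dom_map_of_zip_Delta[OF assms])
qed

lemma chaos_zip_L2:
  assumes "ts \<in> Delta r" "length ks = r"
  shows "chaos (map_of (zip ts ks)) \<in> L2_space P"
  using assms by (intro chaos_L2) (simp add: dom_map_of_zip_Delta)

lemma sum_walk_eq_sum_chaos:
  assumes "A \<subseteq> Delta r" "length ks = r"
  shows "(\<Sum>ts\<in>A. f ts ks * (\<Prod>l<r. walk v (ts ! l) w $ (ks ! l)))
    = (\<Sum>ts\<in>A. f ts ks * chaos (map_of (zip ts ks)) w)"
  using assms by (intro sum.cong refl) (auto simp: prod_walk_eq_chaos)

lemma L2_tendsto_multiple_integral_component:
  assumes f: "L2_kernel r f" and ks: "length ks = r"
  shows "L2_tendsto P (\<lambda>A w. \<Sum>ts\<in>A. f ts ks * (\<Prod>l<r. walk v (ts ! l) w $ (ks ! l)))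
    (L2_lim P (\<lambda>A w. \<Sum>ts\<in>A. f ts ks * (\<Prod>l<r. walk v (ts ! l) w $ (ks ! l)))
      (finite_subsets_at_top (Delta r)))
    (finite_subsets_at_top (Delta r))"
proof -
  let ?x = "\<lambda>ts w. f ts ks * (\<Prod>l<r. walk v (ts ! l) w $ (ks ! l))"
  let ?k = "\<lambda>ts. map_of (zip ts ks)"
  have x: "?x ts = (\<lambda>w. f ts ks * chaos (?k ts) w)" if "ts \<in> Delta r" for ts
    using prod_walk_eq_chaos[OF that ks] by simp
  have inner: "(\<integral>w. ?x ts w * ?x ts' w \<partial>P) = (if ?k ts = ?k ts' then f ts ks * f ts' ks else 0)"
    if "ts \<in> Delta r" "ts' \<in> Delta r" for ts ts'
  proof -
    have "(\<integral>w. ?x ts w * ?x ts' w \<partial>P)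
        = (\<integral>w. (f ts ks * f ts' ks) * (chaos (?k ts) w * chaos (?k ts') w) \<partial>P)"
      unfolding prod_walk_eq_chaos[OF that(1) ks] prod_walk_eq_chaos[OF that(2) ks]
      by (simp only: mult_ac)
    also have "\<dots> = (f ts ks * f ts' ks) * (if ?k ts = ?k ts' then 1 else 0)"
      by (subst integral_mult_right_zero, subst chaos_orthonormal)
        (use that ks in \<open>auto simp: dom_map_of_zip_Delta\<close>)
    finally show ?thesis by simp
  qed
  have "\<exists>S. L2_tendsto P (\<lambda>A w. \<Sum>ts\<in>A. ?x ts w) S (finite_subsets_at_top (Delta r))"
  proof (rule L2_almost_orthogonal_converges[where N = "fact r"])
    fix ts assume "ts \<in> Delta r"
    then show "?x ts \<in> L2_space P"
      unfolding x[OF \<open>ts \<in> Delta r\<close>] by (intro L2_space_cmult chaos_zip_L2[OF _ ks])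
  next
    fix A ts assume A: "finite A" "A \<subseteq> Delta r" "ts \<in> A"
    then have ts: "ts \<in> Delta r" by blast
    have "{ts' \<in> A. (\<integral>w. ?x ts w * ?x ts' w \<partial>P) \<noteq> 0} \<subseteq> permutations_of_set (set ts)"
    proof
      fix ts' assume "ts' \<in> {ts' \<in> A. (\<integral>w. ?x ts w * ?x ts' w \<partial>P) \<noteq> 0}"
      then have ts': "ts' \<in> Delta r" "?k ts = ?k ts'"
        using A(2) inner[OF ts] by (auto split: if_splits)
      then have "set ts' = set ts"
        using dom_map_of_zip_Delta[OF ts ks] dom_map_of_zip_Delta[OF ts'(1) ks] by simp
      with ts'(1) show "ts' \<in> permutations_of_set (set ts)"
        by (simp add: permutations_of_set_def Delta_D)
    qed
    then have "card {ts' \<in> A. (\<integral>w. ?x ts w * ?x ts' w \<partial>P) \<noteq> 0} \<le> card (permutations_of_set (set ts))"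
      by (intro card_mono) auto
    also have "\<dots> = fact r" using ts by (simp add: Delta_D distinct_card)
    finally show "card {ts' \<in> A. (\<integral>w. ?x ts w * ?x ts' w \<partial>P) \<noteq> 0} \<le> fact r" .
  next
    have "(\<lambda>ts. (f ts ks)\<^sup>2) summable_on Delta r"
      by (rule summable_on_comparison_test[OF f[unfolded L2_kernel_def]])
        (use ks in \<open>auto intro!: member_le_sum finite_lists_of_length\<close>)
    also have "?this \<longleftrightarrow> (\<lambda>ts. \<integral>w. (?x ts w)\<^sup>2 \<partial>P) summable_on Delta r"
      by (intro summable_on_cong) (simp add: power2_eq_square inner)
    finally show "(\<lambda>ts. \<integral>w. (?x ts w)\<^sup>2 \<partial>P) summable_on Delta r" .
  qed
  then show ?thesis by (auto intro: L2_tendsto_L2_lim)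
qed

lemma multiple_integral_L2:
  assumes "L2_kernel r f"
  shows "multiple_integral P v r f \<in> L2_space P"
proof (cases "r = 0")
  case True
  have "(\<lambda>w. f [] []) \<in> L2_space P" by (rule past_L2[of _ 0]) simp
  with True show ?thesis by (simp add: multiple_integral_def[abs_def])
next
  case False
  have "(\<lambda>w. \<Sum>ks | length ks = r.
        L2_lim P (\<lambda>A w'. \<Sum>ts\<in>A. f ts ks * (\<Prod>l<r. walk v (ts ! l) w' $ (ks ! l)))
          (finite_subsets_at_top (Delta r)) w) \<in> L2_space P"
    using L2_tendsto_multiple_integral_component[OF assms]
    by (intro L2_space_sum) (auto simp: L2_tendsto_def)
  with False show ?thesis by (simp add: multiple_integral_def[abs_def])
qed

text \<open>Inner products may be taken term by term.  The set of index lists carries no order, hence the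
  unordered sum.\<close>

lemma has_sum_multiple_integral_inner:
  assumes f: "L2_kernel r f" and h: "h \<in> L2_space P"
  shows "((\<lambda>ts. \<Sum>ks | length ks = r. f ts ks * (\<integral>w. chaos (map_of (zip ts ks)) w * h w \<partial>P))
    has_sum (\<integral>w. multiple_integral P v r f w * h w \<partial>P)) (Delta r)"
proof (cases "r = 0")
  case True
  then have D: "Delta r = {[]}" "{ks :: 'd list. length ks = r} = {[]}"
    by (auto simp: Delta_def)
  have "multiple_integral P v r f w = f [] []" for w using True by (simp add: multiple_integral_def)
  then show ?thesis unfolding D by (intro has_sum_finiteI) (simp_all add: chaos_empty)
next
  case False
  define L where "L ks = L2_lim P (\<lambda>A w'. \<Sum>ts\<in>A. f ts ks * (\<Prod>l<r. walk v (ts ! l) w' $ (ks ! l)))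
    (finite_subsets_at_top (Delta r))" for ks
  let ?c = "\<lambda>ts ks. \<integral>w. chaos (map_of (zip ts ks)) w * h w \<partial>P"
  note conv = L2_tendsto_multiple_integral_component[OF f, folded L_def]
  have L: "L ks \<in> L2_space P" if "length ks = r" for ks
    using conv[OF that] by (simp add: L2_tendsto_def)
  have component: "((\<lambda>A. \<Sum>ts\<in>A. f ts ks * ?c ts ks) \<longlongrightarrow> (\<integral>w. L ks w * h w \<partial>P))
      (finite_subsets_at_top (Delta r))" if ks: "length ks = r" for ks
  proof (rule Lim_transform_eventually[OF L2_tendsto_integral_mult[OF conv[OF ks] h]])
    show "\<forall>\<^sub>F A in finite_subsets_at_top (Delta r).
        (\<integral>w. (\<Sum>ts\<in>A. f ts ks * (\<Prod>l<r. walk v (ts ! l) w $ (ks ! l))) * h w \<partial>P)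
        = (\<Sum>ts\<in>A. f ts ks * ?c ts ks)"
    proof (rule eventually_finite_subsets_at_top_weakI)
      fix A assume A: "A \<subseteq> Delta r"
      have int: "integrable P (\<lambda>w. chaos (map_of (zip ts ks)) w * h w)" if "ts \<in> A" for ts
        using A that by (intro L2_integrable_mult chaos_zip_L2[OF _ ks] h) auto
      have "(\<integral>w. (\<Sum>ts\<in>A. f ts ks * (\<Prod>l<r. walk v (ts ! l) w $ (ks ! l))) * h w \<partial>P)
          = (\<integral>w. (\<Sum>ts\<in>A. f ts ks * (chaos (map_of (zip ts ks)) w * h w)) \<partial>P)"
        unfolding sum_walk_eq_sum_chaos[OF A ks] by (simp add: sum_distrib_right mult.assoc)
      also have "\<dots> = (\<Sum>ts\<in>A. \<integral>w. f ts ks * (chaos (map_of (zip ts ks)) w * h w) \<partial>P)"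
        by (intro Bochner_Integration.integral_sum integrable_mult_right int)
      finally show "(\<integral>w. (\<Sum>ts\<in>A. f ts ks * (\<Prod>l<r. walk v (ts ! l) w $ (ks ! l))) * h w \<partial>P)
          = (\<Sum>ts\<in>A. f ts ks * ?c ts ks)" by simp
    qed
  qed
  have "((\<lambda>A. \<Sum>ks | length ks = r. \<Sum>ts\<in>A. f ts ks * ?c ts ks)
      \<longlongrightarrow> (\<Sum>ks | length ks = r. \<integral>w. L ks w * h w \<partial>P)) (finite_subsets_at_top (Delta r))"
    by (intro tendsto_sum component) simp
  moreover have "(\<integral>w. multiple_integral P v r f w * h w \<partial>P) = (\<Sum>ks | length ks = r. \<integral>w. L ks w * h w \<partial>P)"
  proof -
    have "(\<integral>w. multiple_integral P v r f w * h w \<partial>P) = (\<integral>w. (\<Sum>ks | length ks = r. L ks w * h w) \<partial>P)"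
      using False by (simp add: multiple_integral_def L_def sum_distrib_right)
    also have "\<dots> = (\<Sum>ks | length ks = r. \<integral>w. L ks w * h w \<partial>P)"
      by (intro Bochner_Integration.integral_sum L2_integrable_mult L h) simp
    finally show ?thesis .
  qed
  ultimately show ?thesis unfolding has_sum_def by (subst (asm) sum.swap) simp
qed

lemma multiple_integral_inner_chaos:
  assumes f: "L2_kernel r f" and fin: "finite (dom \<kappa>)"
  shows "(\<integral>w. multiple_integral P v r f w * chaos \<kappa> w \<partial>P) = kernel_coefficient r f \<kappa>"
proof -
  let ?B = "{ts. ts \<in> Delta r \<and> set ts = dom \<kappa>}"
  have summand: "(\<Sum>ks | length ks = r. f ts ks * (\<integral>w. chaos (map_of (zip ts ks)) w * chaos \<kappa> w \<partial>P))
      = (if set ts = dom \<kappa> then f ts (map (\<lambda>n. the (\<kappa> n)) ts) else 0)" if ts: "ts \<in> Delta r" for ts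
  proof -
    have "(\<Sum>ks | length ks = r. f ts ks * (\<integral>w. chaos (map_of (zip ts ks)) w * chaos \<kappa> w \<partial>P))
        = (\<Sum>ks | length ks = r. if ks = map (\<lambda>n. the (\<kappa> n)) ts
            then (if set ts = dom \<kappa> then f ts ks else 0) else 0)"
    proof (intro sum.cong refl)
      fix ks :: "'d list" assume "ks \<in> {ks. length ks = r}"
      then have ks: "length ks = r" by simp
      have "(\<integral>w. chaos (map_of (zip ts ks)) w * chaos \<kappa> w \<partial>P)
          = (if map_of (zip ts ks) = \<kappa> then 1 else 0)"
        using fin by (intro chaos_orthonormal) (simp_all add: dom_map_of_zip_Delta[OF ts ks])
      then show "f ts ks * (\<integral>w. chaos (map_of (zip ts ks)) w * chaos \<kappa> w \<partial>P)
          = (if ks = map (\<lambda>n. the (\<kappa> n)) ts then (if set ts = dom \<kappa> then f ts ks else 0) else 0)"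
        by (simp add: map_of_zip_eq_iff[OF ts ks])
    qed
    then show ?thesis using Delta_D(1)[OF ts] by (simp add: finite_lists_of_length)
  qed
  have "finite ?B" using Delta_with_set[OF fin, of r] by simp
  then have "((\<lambda>ts. \<Sum>ks | length ks = r. f ts ks * (\<integral>w. chaos (map_of (zip ts ks)) w * chaos \<kappa> w \<partial>P))
      has_sum kernel_coefficient r f \<kappa>) (Delta r)"
    by (rule has_sum_finite_neutralI) (auto simp: summand kernel_coefficient_def)
  with has_sum_multiple_integral_inner[OF f chaos_L2[OF fin]] show ?thesis
    by (rule has_sum_unique)
qed

text \<open>The partial sums are eventually constant along the net of finite sets, so no limit is
  involved; still, the equality holds only almost everywhere, because \<open>L2_lim\<close> chooses a
  representative.\<close>

lemma multiple_integral_finite_support: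
  assumes B: "finite B" "B \<subseteq> Delta r"
    and supp: "\<And>ts ks. ts \<in> Delta r - B \<Longrightarrow> length ks = r \<Longrightarrow> f ts ks = 0"
  shows "AE w in P. multiple_integral P v r f w
    = (\<Sum>ts\<in>B. \<Sum>ks | length ks = r. f ts ks * chaos (map_of (zip ts ks)) w)"
proof (cases "r = 0")
  case True
  then have D: "Delta r = {[]}" "{ks :: 'd list. length ks = r} = {[]}"
    by (auto simp: Delta_def)
  have I: "multiple_integral P v r f w = f [] []" for w
    using True by (simp add: multiple_integral_def)
  from B D(1) have "B = {} \<or> B = {[]}" by auto
  then show ?thesis
  proof
    assume "B = {}"
    moreover from this have "f [] [] = 0" using supp[of "[]" "[]"] D(1) True by simp
    ultimately show ?thesis unfolding I by simp
  next
    assume "B = {[]}"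
    then show ?thesis unfolding I D by (simp add: chaos_empty)
  qed
next
  case False
  have "AE w in P. \<forall>ks\<in>{ks. length ks = r}.
      L2_lim P (\<lambda>A w'. \<Sum>ts\<in>A. f ts ks * (\<Prod>l<r. walk v (ts ! l) w' $ (ks ! l)))
        (finite_subsets_at_top (Delta r)) w
      = (\<Sum>ts\<in>B. f ts ks * chaos (map_of (zip ts ks)) w)"
  proof (intro AE_finite_allI finite_lists_of_length L2_lim_AE_eq finite_subsets_at_top_neq_bot
      L2_tendsto_eventually_AE_eq)
    fix ks :: "'d list" assume "ks \<in> {ks. length ks = r}"
    then have ks: "length ks = r" by simp
    show S: "(\<lambda>w. \<Sum>ts\<in>B. f ts ks * chaos (map_of (zip ts ks)) w) \<in> L2_space P"
      using B(2) ks by (intro L2_space_sum L2_space_cmult chaos_zip_L2[of _ r]) auto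
    show "\<forall>\<^sub>F A in finite_subsets_at_top (Delta r).
        (\<lambda>w. \<Sum>ts\<in>A. f ts ks * (\<Prod>l<r. walk v (ts ! l) w $ (ks ! l))) \<in> L2_space P \<and>
        (AE w in P. (\<Sum>ts\<in>A. f ts ks * (\<Prod>l<r. walk v (ts ! l) w $ (ks ! l)))
          = (\<Sum>ts\<in>B. f ts ks * chaos (map_of (zip ts ks)) w))"
      unfolding eventually_finite_subsets_at_top
    proof (intro exI[of _ B] conjI allI impI B)
      fix A assume A: "finite A \<and> B \<subseteq> A \<and> A \<subseteq> Delta r"
      have "(\<Sum>ts\<in>A. f ts ks * (\<Prod>l<r. walk v (ts ! l) w $ (ks ! l)))
          = (\<Sum>ts\<in>B. f ts ks * chaos (map_of (zip ts ks)) w)" for w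
        using A ks supp by (subst sum_walk_eq_sum_chaos[of A])
          (auto intro!: sum.mono_neutral_right)
      with S show "(\<lambda>w. \<Sum>ts\<in>A. f ts ks * (\<Prod>l<r. walk v (ts ! l) w $ (ks ! l))) \<in> L2_space P"
        and "AE w in P. (\<Sum>ts\<in>A. f ts ks * (\<Prod>l<r. walk v (ts ! l) w $ (ks ! l)))
          = (\<Sum>ts\<in>B. f ts ks * chaos (map_of (zip ts ks)) w)"
        by simp_all
    qed
  qed
  then show ?thesis
  proof eventually_elim
    case (elim w)
    with False show ?case
      by (simp add: multiple_integral_def sum.swap[of _ B])
  qed
qed

section \<open>The gradient\<close>

text \<open>The gradient is an annihilation operator: its adjoint adds the time \<open>k\<close> with label \<open>j\<close>
  to a product of the walk that does not yet contain \<open>k\<close>.\<close>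

lemma gradient_on_S_inner_chaos:
  assumes grad: "gradient_on_S P v k j F G" and fin: "finite (dom \<kappa>)"
  shows "(\<integral>w. G w * chaos \<kappa> w \<partial>P)
    = (if k \<in> dom \<kappa> then 0 else \<integral>w. F w * chaos (\<kappa>(k \<mapsto> j)) w \<partial>P)"
proof -
  obtain n f where L2: "F \<in> L2_space P" "G \<in> L2_space P"
    and f: "\<And>r. r \<le> n \<Longrightarrow> symmetric_kernel r (f r)" "\<And>r. r \<le> n \<Longrightarrow> L2_kernel r (f r)"
    and F: "AE w in P. F w = (\<Sum>r\<le>n. multiple_integral P v r (f r) w)"
    and G: "AE w in P. G w
      = (\<Sum>r=1..n. real r * multiple_integral P v (r - 1) (gradient_kernel k j (f r)) w)"
    using grad unfolding gradient_on_S_def by blast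
  have int: "(\<integral>w. H w * h w \<partial>P) = (\<Sum>r\<in>R. c r * (\<integral>w. J r w * h w \<partial>P))"
    if "H \<in> L2_space P" "h \<in> L2_space P" "\<And>r. r \<in> R \<Longrightarrow> J r \<in> L2_space P"
      and H: "AE w in P. H w = (\<Sum>r\<in>R. c r * J r w)" for H h c J and R :: "nat set"
  proof -
    have "(\<integral>w. H w * h w \<partial>P) = (\<integral>w. (\<Sum>r\<in>R. c r * (J r w * h w)) \<partial>P)"
    proof (rule integral_cong_AE)
      show "AE w in P. H w * h w = (\<Sum>r\<in>R. c r * (J r w * h w))"
        using H by eventually_elim (simp add: sum_distrib_right mult.assoc)
    qed (use that in \<open>auto intro!: borel_measurable_sum borel_measurable_times dest: L2_spaceD(1)\<close>)
    also have "\<dots> = (\<Sum>r\<in>R. \<integral>w. c r * (J r w * h w) \<partial>P)"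
      using that by (intro Bochner_Integration.integral_sum integrable_mult_right L2_integrable_mult)
    finally show ?thesis by simp
  qed
  have fg: "L2_kernel (r - 1) (gradient_kernel k j (f r))" if "r \<in> {1..n}" for r
    using that f(2)[of r] by (cases r) (auto intro: L2_kernel_gradient_kernel)
  have "(\<integral>w. G w * chaos \<kappa> w \<partial>P) = (\<Sum>r=1..n. real r *
      (\<integral>w. multiple_integral P v (r - 1) (gradient_kernel k j (f r)) w * chaos \<kappa> w \<partial>P))"
    by (intro int L2(2) chaos_L2 fin multiple_integral_L2 fg G)
  also have "\<dots> = (\<Sum>r=1..n. real r * kernel_coefficient (r - 1) (gradient_kernel k j (f r)) \<kappa>)"
    by (intro sum.cong refl) (simp only: multiple_integral_inner_chaos[OF fg fin])
  also have "\<dots> = (\<Sum>r=1..n. if k \<in> dom \<kappa> then 0 else kernel_coefficient r (f r) (\<kappa>(k \<mapsto> j)))"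
  proof (intro sum.cong refl)
    fix r assume r: "r \<in> {1..n}"
    then obtain r' where r': "r = Suc r'" by (cases r) auto
    from kernel_coefficient_gradient[OF _ fin, of r' "f r" k j] f(1)[of r] r
    show "real r * kernel_coefficient (r - 1) (gradient_kernel k j (f r)) \<kappa>
        = (if k \<in> dom \<kappa> then 0 else kernel_coefficient r (f r) (\<kappa>(k \<mapsto> j)))"
      unfolding r' by simp
  qed
  finally have G_eq: "(\<integral>w. G w * chaos \<kappa> w \<partial>P)
      = (if k \<in> dom \<kappa> then 0 else \<Sum>r=1..n. kernel_coefficient r (f r) (\<kappa>(k \<mapsto> j)))" by simp
  show ?thesis
  proof (cases "k \<in> dom \<kappa>")
    case False
    have fin': "finite (dom (\<kappa>(k \<mapsto> j)))" using fin by simp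
    have "(\<integral>w. F w * chaos (\<kappa>(k \<mapsto> j)) w \<partial>P)
        = (\<Sum>r\<le>n. 1 * (\<integral>w. multiple_integral P v r (f r) w * chaos (\<kappa>(k \<mapsto> j)) w \<partial>P))"
      using F by (intro int L2(1) chaos_L2 fin' multiple_integral_L2 f(2)) auto
    also have "\<dots> = (\<Sum>r\<le>n. kernel_coefficient r (f r) (\<kappa>(k \<mapsto> j)))"
      by (intro sum.cong refl) (simp add: multiple_integral_inner_chaos[OF f(2) fin'])
    also have "\<dots> = (\<Sum>r=1..n. kernel_coefficient r (f r) (\<kappa>(k \<mapsto> j)))"
    proof (rule sum.mono_neutral_right)
      show "\<forall>r\<in>{..n} - {1..n}. kernel_coefficient r (f r) (\<kappa>(k \<mapsto> j)) = 0"
        by (auto simp: kernel_coefficient_def Delta_def not_le intro!: sum.neutral)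
    qed auto
    finally show ?thesis using G_eq False by simp
  qed (use G_eq in simp)
qed

text \<open>The adjoint relation pairs with fixed elements of $L^2$ and is therefore inherited by
  $L^2$-limits.  This is why the extension of the gradient is determined by its argument.\<close>

lemma has_gradient_inner_chaos:
  assumes grad: "has_gradient P v k j F G" and fin: "finite (dom \<kappa>)"
  shows "(\<integral>w. G w * chaos \<kappa> w \<partial>P)
    = (if k \<in> dom \<kappa> then 0 else \<integral>w. F w * chaos (\<kappa>(k \<mapsto> j)) w \<partial>P)"
proof -
  obtain Fs Gs where FG: "\<And>m. gradient_on_S P v k j (Fs m) (Gs m)"
    "L2_tendsto P Fs F sequentially" "L2_tendsto P Gs G sequentially"
    using grad unfolding has_gradient_def by blast
  have fin': "finite (dom (\<kappa>(k \<mapsto> j)))" using fin by simp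
  have "(\<lambda>m. if k \<in> dom \<kappa> then 0 else \<integral>w. Fs m w * chaos (\<kappa>(k \<mapsto> j)) w \<partial>P)
      \<longlonglongrightarrow> (if k \<in> dom \<kappa> then 0 else \<integral>w. F w * chaos (\<kappa>(k \<mapsto> j)) w \<partial>P)"
    using L2_tendsto_integral_mult[OF FG(2) chaos_L2[OF fin']] by simp
  then have "(\<lambda>m. \<integral>w. Gs m w * chaos \<kappa> w \<partial>P)
      \<longlonglongrightarrow> (if k \<in> dom \<kappa> then 0 else \<integral>w. F w * chaos (\<kappa>(k \<mapsto> j)) w \<partial>P)"
    by (simp only: gradient_on_S_inner_chaos[OF FG(1) fin])
  with L2_tendsto_integral_mult[OF FG(3) chaos_L2[OF fin]] show ?thesis
    by (rule LIMSEQ_unique)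
qed

lemma multiple_integral_orthogonal:
  assumes f: "L2_kernel r f" and h: "h \<in> L2_space P"
    and orth: "\<And>\<kappa>. finite (dom \<kappa>) \<Longrightarrow> (\<integral>w. chaos \<kappa> w * h w \<partial>P) = 0"
  shows "(\<integral>w. multiple_integral P v r f w * h w \<partial>P) = 0"
proof -
  have "((\<lambda>ts. \<Sum>ks | length ks = r. f ts ks * (\<integral>w. chaos (map_of (zip ts ks)) w * h w \<partial>P))
      has_sum 0) (Delta r)"
    by (intro has_sum_0) (auto intro!: sum.neutral orth simp: dom_map_of_zip_Delta)
  with has_sum_multiple_integral_inner[OF f h] show ?thesis by (rule has_sum_unique)
qed

text \<open>The adjoint relation moves the time \<open>k\<close> into the product that is paired with \<open>F\<close>, and
  \<open>F\<close> is orthogonal to every such product.  So \<open>G\<close> is orthogonal to all products of the walk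
  and hence to all multiple integrals.  But \<open>G\<close> is itself an $L^2$-limit of sums of multiple
  integrals, so it is orthogonal to itself.\<close>

lemma has_gradient_past_unique:
  assumes F: "F \<in> borel_measurable (past CARD('d) k)" and grad: "has_gradient P v k j F G"
  shows "AE w in P. G w = 0"
proof -
  obtain Fs Gs where FG: "\<And>m. gradient_on_S P v k j (Fs m) (Gs m)"
    "L2_tendsto P Gs G sequentially"
    using grad unfolding has_gradient_def by blast
  have G: "G \<in> L2_space P" using FG(2) by (simp add: L2_tendsto_def)
  have orth: "(\<integral>w. chaos \<kappa> w * G w \<partial>P) = 0" if "finite (dom \<kappa>)" for \<kappa>
    using has_gradient_inner_chaos[OF grad that] integral_past_times_chaos[OF F, of "\<kappa>(k \<mapsto> j)"] that
    by (simp add: mult.commute)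
  have "(\<integral>w. Gs m w * G w \<partial>P) = 0" for m
  proof -
    obtain n f where L2: "Gs m \<in> L2_space P"
      and f: "\<And>r. r \<le> n \<Longrightarrow> L2_kernel r (f r)"
      and Gs: "AE w in P. Gs m w
        = (\<Sum>r=1..n. real r * multiple_integral P v (r - 1) (gradient_kernel k j (f r)) w)"
      using FG(1)[of m] unfolding gradient_on_S_def by blast
    let ?J = "\<lambda>r. multiple_integral P v (r - 1) (gradient_kernel k j (f r))"
    have fg: "L2_kernel (r - 1) (gradient_kernel k j (f r))" if "r \<in> {1..n}" for r
      using that f[of r] by (cases r) (auto intro: L2_kernel_gradient_kernel)
    note J = multiple_integral_L2[OF fg]
    have "(\<integral>w. Gs m w * G w \<partial>P) = (\<integral>w. (\<Sum>r=1..n. real r * (?J r w * G w)) \<partial>P)"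
    proof (rule integral_cong_AE)
      show "AE w in P. Gs m w * G w = (\<Sum>r=1..n. real r * (?J r w * G w))"
        using Gs by eventually_elim (simp add: sum_distrib_right mult.assoc)
    qed (intro borel_measurable_sum borel_measurable_times borel_measurable_const
        L2 G J L2_spaceD(1))+
    also have "\<dots> = (\<Sum>r=1..n. \<integral>w. real r * (?J r w * G w) \<partial>P)"
      by (intro Bochner_Integration.integral_sum integrable_mult_right L2_integrable_mult J G)
    also have "\<dots> = (\<Sum>r=1..n. real r * (\<integral>w. ?J r w * G w \<partial>P))" by simp
    also have "\<dots> = 0"
      by (intro sum.neutral ballI) (simp only: multiple_integral_orthogonal[OF fg G orth] mult_zero_right)
    finally show ?thesis .
  qed
  with L2_tendsto_integral_mult[OF FG(2) G] have "(\<integral>w. G w * G w \<partial>P) = 0"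
    by (simp add: LIMSEQ_const_iff)
  then have "(\<integral>w. (G w)\<^sup>2 \<partial>P) = 0" by (simp add: power2_eq_square)
  with G show ?thesis by (rule L2_norm_zero_AE)
qed

text \<open>Each partial map with a domain of size $r$ comes from exactly $r!$ pairs of lists, one for each
  enumeration of its domain.\<close>

lemma sum_symmetrized_kernel:
  fixes c :: "(nat \<Rightarrow> 'd option) \<Rightarrow> real" and k :: nat
  defines "B \<equiv> \<lambda>r. {ts \<in> Delta r. set ts \<subseteq> {..<k}}"
  shows "(\<Sum>ts\<in>B r. \<Sum>ks | length ks = r. c (map_of (zip ts ks)) / fact r)
    = (\<Sum>\<kappa> | \<kappa> \<in> maps_below k \<and> card (dom \<kappa>) = r. c \<kappa>)"
proof -
  let ?K = "{\<kappa>. \<kappa> \<in> maps_below k \<and> card (dom \<kappa>) = r} :: (nat \<Rightarrow> 'd option) set"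
  have finB: "finite (B r)"
    by (rule finite_subset[OF _ finite_lists_length_eq[of "{..<k}" r]]) (auto simp: B_def Delta_def)
  have finK: "finite ?K" by (rule finite_subset[OF _ finite_maps_below[of k]]) auto
  have "(\<Sum>ts\<in>B r. \<Sum>ks | length ks = r. c (map_of (zip ts ks)) / fact r)
      = (\<Sum>ts\<in>B r. \<Sum>\<kappa> | \<kappa> \<in> ?K \<and> dom \<kappa> = set ts. c \<kappa> / fact r)"
  proof (rule sum.cong[OF refl])
    fix ts assume "ts \<in> B r"
    then have ts: "ts \<in> Delta r" "set ts \<subseteq> {..<k}" by (auto simp: B_def)
    have card: "card (set ts) = r" using ts(1) by (simp add: Delta_D distinct_card)
    show "(\<Sum>ks | length ks = r. c (map_of (zip ts ks)) / fact r)
        = (\<Sum>\<kappa> | \<kappa> \<in> ?K \<and> dom \<kappa> = set ts. c \<kappa> / fact r)"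
    proof (rule sum.reindex_bij_witness[of _ "\<lambda>\<kappa>. map (\<lambda>n. the (\<kappa> n)) ts"
          "\<lambda>ks. map_of (zip ts ks)"])
      fix ks :: "'d list" assume "ks \<in> {ks. length ks = r}"
      then have ks: "length ks = r" by simp
      from map_of_zip_eq_iff[OF ts(1) ks, of "map_of (zip ts ks)"]
      show "map (\<lambda>n. the (map_of (zip ts ks) n)) ts = ks" by simp
      show "map_of (zip ts ks) \<in> {\<kappa>. \<kappa> \<in> ?K \<and> dom \<kappa> = set ts}"
        using ts(2) card by (simp add: maps_below_def dom_map_of_zip_Delta[OF ts(1) ks])
    next
      fix \<kappa> assume \<kappa>: "\<kappa> \<in> {\<kappa>. \<kappa> \<in> ?K \<and> dom \<kappa> = set ts}"
      have len: "length (map (\<lambda>n. the (\<kappa> n)) ts) = r" using ts(1) by (simp add: Delta_D)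
      then show "map (\<lambda>n. the (\<kappa> n)) ts \<in> {ks. length ks = r}" by simp
      from \<kappa> show "map_of (zip ts (map (\<lambda>n. the (\<kappa> n)) ts)) = \<kappa>"
        using map_of_zip_eq_iff[OF ts(1) len, of \<kappa>] by simp
    qed simp
  qed
  also have "\<dots> = (\<Sum>\<kappa>\<in>?K. \<Sum>ts | ts \<in> B r \<and> dom \<kappa> = set ts. c \<kappa> / fact r)"
    by (rule sum.swap_restrict[OF finB finK])
  also have "\<dots> = (\<Sum>\<kappa>\<in>?K. c \<kappa>)"
  proof (rule sum.cong[OF refl])
    fix \<kappa> assume \<kappa>: "\<kappa> \<in> ?K"
    then have fin: "finite (dom \<kappa>)" by (auto simp: maps_below_def intro: finite_subset)
    have "{ts. ts \<in> B r \<and> dom \<kappa> = set ts} = {ts \<in> Delta r. set ts = dom \<kappa>}"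
      using \<kappa> unfolding B_def maps_below_def by blast
    also have "\<dots> = permutations_of_set (dom \<kappa>)"
      using \<kappa> by (simp add: Delta_with_set[OF fin])
    finally have "{ts. ts \<in> B r \<and> dom \<kappa> = set ts} = permutations_of_set (dom \<kappa>)" .
    with \<kappa> fin show "(\<Sum>ts | ts \<in> B r \<and> dom \<kappa> = set ts. c \<kappa> / fact r) = c \<kappa>" by simp
  qed
  finally show ?thesis .
qed

text \<open>The finite chaos expansion of \<open>F\<close> only uses times before \<open>k\<close>.  Symmetrizing its
  coefficients gives kernels that vanish as soon as one argument is \<open>k\<close>, so that all gradient
  kernels are zero.\<close>

lemma has_gradient_past_zero:
  assumes F: "F \<in> borel_measurable (past CARD('d) k)"
  shows "has_gradient P v k j F (\<lambda>_. 0)"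
proof -
  obtain c where c: "AE w in P. F w = (\<Sum>\<kappa>\<in>maps_below k. c \<kappa> * chaos \<kappa> w)"
    using past_chaos_expansion[OF F] by blast
  define f :: "nat \<Rightarrow> nat list \<Rightarrow> 'd list \<Rightarrow> real" where
    "f r ts ks = (if set ts \<subseteq> {..<k} then c (map_of (zip ts ks)) / fact r else 0)" for r ts ks
  let ?B = "\<lambda>r. {ts \<in> Delta r. set ts \<subseteq> {..<k}}"
  have finB: "finite (?B r)" for r
    by (rule finite_subset[OF _ finite_lists_length_eq[of "{..<k}" r]]) (auto simp: Delta_def)
  have sym: "symmetric_kernel r (f r)" for r
    unfolding symmetric_kernel_def
  proof (intro ballI allI impI)
    fix ts ks p assume ts: "ts \<in> Delta r" and ks: "length (ks :: 'd list) = r" and p: "p permutes {..<r}"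
    then have p': "p permutes {..<length (zip ts ks)}" by (simp add: Delta_D)
    have zip: "permute_list p (zip ts ks) = zip (permute_list p ts) (permute_list p ks)"
      using ts ks p by (intro permute_list_zip[of p "{..<r}"]) (auto simp: Delta_D)
    have "map_of (permute_list p (zip ts ks)) = map_of (zip ts ks)"
    proof (subst map_of_inject_set)
      show "distinct (map fst (zip ts ks))" using ts ks by (simp add: Delta_D)
      then show "distinct (map fst (permute_list p (zip ts ks)))"
        using p' by (simp add: permute_list_map[symmetric])
    qed (use p' in simp)
    then show "f r (permute_list p ts) (permute_list p ks) = f r ts ks"
      using ts p by (simp add: f_def zip Delta_D)
  qed
  have L2: "L2_kernel r (f r)" for r
  proof -
    have "(\<lambda>ts. \<Sum>ks | length ks = r. (f r ts ks)\<^sup>2) summable_on ?B r"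
      using finB by (rule summable_on_finite)
    also have "?this \<longleftrightarrow> L2_kernel r (f r)"
      unfolding L2_kernel_def by (intro summable_on_cong_neutral) (auto simp: f_def)
    finally show ?thesis .
  qed
  have "AE w in P. \<forall>r\<in>{..k}. multiple_integral P v r (f r) w
      = (\<Sum>ts\<in>?B r. \<Sum>ks | length ks = r. f r ts ks * chaos (map_of (zip ts ks)) w)"
    by (intro AE_finite_allI multiple_integral_finite_support finB) (auto simp: f_def)
  with c have F_eq: "AE w in P. F w = (\<Sum>r\<le>k. multiple_integral P v r (f r) w)"
  proof eventually_elim
    case (elim w)
    have card: "card (dom \<kappa>) \<le> k" if "\<kappa> \<in> maps_below k" for \<kappa> :: "nat \<Rightarrow> 'd option"
      using card_mono[of "{..<k}" "dom \<kappa>"] that by (simp add: maps_below_def)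
    have "(\<Sum>r\<le>k. multiple_integral P v r (f r) w)
        = (\<Sum>r\<le>k. \<Sum>ts\<in>?B r. \<Sum>ks | length ks = r.
            c (map_of (zip ts ks)) * chaos (map_of (zip ts ks)) w / fact r)"
    proof (rule sum.cong[OF refl])
      fix r assume "r \<in> {..k}"
      with elim(2) have "multiple_integral P v r (f r) w
        = (\<Sum>ts\<in>?B r. \<Sum>ks | length ks = r. f r ts ks * chaos (map_of (zip ts ks)) w)" by blast
      also have "\<dots> = (\<Sum>ts\<in>?B r. \<Sum>ks | length ks = r.
            c (map_of (zip ts ks)) * chaos (map_of (zip ts ks)) w / fact r)"
        by (intro sum.cong refl) (simp add: f_def)
      finally show "multiple_integral P v r (f r) w
        = (\<Sum>ts\<in>?B r. \<Sum>ks | length ks = r.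
            c (map_of (zip ts ks)) * chaos (map_of (zip ts ks)) w / fact r)" .
    qed
    also have "\<dots> = (\<Sum>r\<le>k. \<Sum>\<kappa> | \<kappa> \<in> maps_below k \<and> card (dom \<kappa>) = r. c \<kappa> * chaos \<kappa> w)"
      by (intro sum.cong refl) (rule sum_symmetrized_kernel)
    also have "\<dots> = (\<Sum>\<kappa>\<in>maps_below k. c \<kappa> * chaos \<kappa> w)"
      by (rule sum.group) (auto simp: finite_maps_below card)
    finally show ?case using elim(1) by simp
  qed
  have G0: "AE w in P. multiple_integral P v (r - 1) (gradient_kernel k j (f r)) w = 0" for r
    using multiple_integral_finite_support[of "{}" "r - 1" "gradient_kernel k j (f r)"]
    by (simp add: gradient_kernel_def f_def)
  have "AE w in P. \<forall>r\<in>{1..k}. multiple_integral P v (r - 1) (gradient_kernel k j (f r)) w = 0"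
    by (intro AE_finite_allI G0) simp
  then have G_eq: "AE w in P. 0
      = (\<Sum>r=1..k. real r * multiple_integral P v (r - 1) (gradient_kernel k j (f r)) w)"
    by eventually_elim simp
  have grad: "gradient_on_S P v k j F (\<lambda>_. 0)"
    unfolding gradient_on_S_def
    using past_L2[OF F] L2_space_zero sym L2 F_eq G_eq by blast
  show ?thesis
    unfolding has_gradient_def
    using grad past_L2[OF F]
    by (intro exI[of _ "\<lambda>_. F"] exI[of _ "\<lambda>_ _. 0"])
      (auto intro!: L2_tendsto_eventually_AE_eq L2_space_zero)
qed

text \<open>Existence of a gradient makes the choice in \<open>gradient\<close> meaningful, and uniqueness identifies
  the chosen value.\<close>

lemma gradient_past_zero:
  assumes F: "F \<in> borel_measurable (past CARD('d) k)"
  shows "AE w in P. gradient P v k F w = 0"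
    and "(\<lambda>w. gradient P v k F w $ j) \<in> borel_measurable P"
proof -
  let ?G = "\<lambda>j. SOME G. has_gradient P v k j F G"
  have G: "has_gradient P v k j F (?G j)" for j
    by (rule someI[of "\<lambda>G. has_gradient P v k j F G", OF has_gradient_past_zero[OF F]])
  have "AE w in P. \<forall>j. ?G j w = 0"
    using has_gradient_past_unique[OF F G] by (simp add: AE_all_countable)
  then show "AE w in P. gradient P v k F w = 0"
    by eventually_elim (simp add: gradient_def vec_eq_iff)
  have "?G j \<in> L2_space P"
    using G[of j] by (auto simp: has_gradient_def L2_tendsto_def)
  then show "(\<lambda>w. gradient P v k F w $ j) \<in> borel_measurable P"
    by (auto simp: gradient_def dest: L2_spaceD(1))
qed

section \<open>Divergence and stochastic integral of a predictable process\<close>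

lemma walk_inner_measurable_past:
  assumes "X \<in> borel_measurable (past CARD('d) k)"
  shows "(\<lambda>w. X w \<bullet> walk v k w) \<in> borel_measurable (past CARD('d) (Suc k))"
  unfolding inner_vec_def inner_real_def
  by (intro borel_measurable_sum borel_measurable_times walk_measurable_past
      borel_measurable_vec_nth_comp measurable_past_mono[OF assms]) auto

lemma walk_inner_orthogonal:
  assumes X: "X \<in> borel_measurable (past CARD('d) k)" and H: "H \<in> borel_measurable (past CARD('d) k)"
  shows "(\<integral>w. H w * (X w \<bullet> walk v k w) \<partial>P) = 0"
proof -
  have m: "(\<lambda>w. H w * X w $ i) \<in> borel_measurable (past CARD('d) k)" for i
    by (intro borel_measurable_times H borel_measurable_vec_nth_comp X)
  have "(\<integral>w. H w * (X w \<bullet> walk v k w) \<partial>P) = (\<integral>w. (\<Sum>i\<in>UNIV. (H w * X w $ i) * walk v k w $ i) \<partial>P)"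
    by (simp add: inner_vec_def sum_distrib_left mult.assoc)
  also have "\<dots> = (\<Sum>i\<in>UNIV. \<integral>w. (H w * X w $ i) * walk v k w $ i \<partial>P)"
    by (intro Bochner_Integration.integral_sum L2_integrable_mult past_L2[OF m]
        past_L2[OF walk_measurable_past[OF lessI]])
  also have "\<dots> = 0" by (simp only: integral_past_times_walk[OF m] sum.neutral_const)
  finally show ?thesis .
qed

lemma walk_inner_isometry:
  assumes X: "X \<in> borel_measurable (past CARD('d) k)"
  shows "(\<integral>w. (X w \<bullet> walk v k w)\<^sup>2 \<partial>P) = (\<integral>w. (norm (X w))\<^sup>2 \<partial>P)"
proof -
  have m: "(\<lambda>w. X w $ i * X w $ j) \<in> borel_measurable (past CARD('d) k)" for i j
    by (intro borel_measurable_times borel_measurable_vec_nth_comp X)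
  have Y: "(\<lambda>w. walk v k w $ i * walk v k w $ j) \<in> borel_measurable (past CARD('d) (Suc k))" for i j
    by (intro borel_measurable_times walk_measurable_past) auto
  note int = L2_integrable_mult[OF past_L2[OF m] past_L2[OF Y]]
  have "(\<integral>w. (X w \<bullet> walk v k w)\<^sup>2 \<partial>P)
      = (\<integral>w. (\<Sum>i\<in>UNIV. \<Sum>j\<in>UNIV. (X w $ i * X w $ j) * (walk v k w $ i * walk v k w $ j)) \<partial>P)"
    by (simp add: inner_vec_def power2_eq_square sum_product mult_ac)
  also have "\<dots> = (\<Sum>i\<in>UNIV. \<integral>w. (\<Sum>j\<in>UNIV. (X w $ i * X w $ j) * (walk v k w $ i * walk v k w $ j)) \<partial>P)"
    by (intro Bochner_Integration.integral_sum Bochner_Integration.integrable_sum int)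
  also have "\<dots> = (\<Sum>i\<in>UNIV. \<Sum>j\<in>UNIV. \<integral>w. (X w $ i * X w $ j) * (walk v k w $ i * walk v k w $ j) \<partial>P)"
    by (intro sum.cong refl Bochner_Integration.integral_sum int)
  also have "\<dots> = (\<Sum>i\<in>UNIV. \<integral>w. X w $ i * X w $ i \<partial>P)"
    unfolding integral_past_times_walk_walk[OF m] by simp
  also have "\<dots> = (\<integral>w. (\<Sum>i\<in>UNIV. X w $ i * X w $ i) \<partial>P)"
    by (intro Bochner_Integration.integral_sum[symmetric] past_integrable[OF m])
  also have "\<dots> = (\<integral>w. (norm (X w))\<^sup>2 \<partial>P)"
    by (simp add: power2_norm_eq_inner inner_vec_def)
  finally show ?thesis .
qed

text \<open>The terms are pairwise orthogonal, and the squared norm of the term at time $k$ is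
  $\mathbb{E} \|X_k\|^2$.\<close>

lemma stochastic_integral_converges:
  assumes X: "L2_process P X" and pred: "predictable X"
  shows "L2_tendsto P (\<lambda>n w. \<Sum>k<n. X k w \<bullet> walk v k w) (stochastic_integral P v X) sequentially"
proof -
  let ?x = "\<lambda>k w. X k w \<bullet> walk v k w"
  have Xk: "X k \<in> borel_measurable (past CARD('d) k)" for k
    using pred by (simp add: predictable_def)
  note xk = walk_inner_measurable_past[OF Xk]
  have less: "(\<integral>w. ?x k w * ?x l w \<partial>P) = 0" if "k < l" for k l
    using that by (intro walk_inner_orthogonal Xk measurable_past_mono[OF xk]) auto
  have orth: "(\<integral>w. ?x k w * ?x l w \<partial>P) = 0" if "k \<noteq> l" for k l
    using that less[of k l] less[of l k] by (cases "k < l") (auto simp: mult.commute)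
  have norm_int: "integrable P (\<lambda>w. (norm (X k w))\<^sup>2)" for k
    by (rule past_integrable[of _ k]) (use Xk[of k] in measurable)
  have "(\<Sum>k. ennreal (\<integral>w. (norm (X k w))\<^sup>2 \<partial>P)) = (\<Sum>k. \<integral>\<^sup>+w. ennreal ((norm (X k w))\<^sup>2) \<partial>P)"
    by (intro suminf_cong nn_integral_eq_integral[symmetric] norm_int) simp
  also have "\<dots> = (\<integral>\<^sup>+w. (\<Sum>k. ennreal ((norm (X k w))\<^sup>2)) \<partial>P)"
    using past_borel[OF Xk] by (intro nn_integral_suminf[symmetric]) measurable
  also have "\<dots> < \<infinity>" using X by (simp add: L2_process_def)
  finally have "summable (\<lambda>k. \<integral>w. (norm (X k w))\<^sup>2 \<partial>P)"
    by (intro summable_suminf_not_top) auto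
  then have summ: "(\<lambda>k. \<integral>w. (?x k w)\<^sup>2 \<partial>P) summable_on UNIV"
    unfolding walk_inner_isometry[OF Xk] by (intro norm_summable_imp_summable_on) simp
  have "\<exists>S. L2_tendsto P (\<lambda>A w. \<Sum>k\<in>A. ?x k w) S (finite_subsets_at_top UNIV)"
  proof (rule L2_almost_orthogonal_converges[where N = 1])
    show "?x k \<in> L2_space P" for k by (rule past_L2[OF xk])
    fix A :: "nat set" and k assume "finite A" "k \<in> A"
    have "{l \<in> A. (\<integral>w. ?x k w * ?x l w \<partial>P) \<noteq> 0} \<subseteq> {k}"
    proof
      fix l assume "l \<in> {l \<in> A. (\<integral>w. ?x k w * ?x l w \<partial>P) \<noteq> 0}"
      then show "l \<in> {k}" by (cases "k = l") (simp_all add: orth)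
    qed
    then have "card {l \<in> A. (\<integral>w. ?x k w * ?x l w \<partial>P) \<noteq> 0} \<le> card {k}"
      by (intro card_mono) simp_all
    then show "card {l \<in> A. (\<integral>w. ?x k w * ?x l w \<partial>P) \<noteq> 0} \<le> 1" by simp
  qed (rule summ)
  then obtain S where S: "L2_tendsto P (\<lambda>A w. \<Sum>k\<in>A. ?x k w) S (finite_subsets_at_top UNIV)"
    by blast
  have "filterlim (\<lambda>n. {..<n}) (finite_subsets_at_top UNIV) (sequentially :: nat filter)"
    unfolding filterlim_finite_subsets_at_top
  proof (intro allI impI)
    fix A :: "nat set" assume "finite A \<and> A \<subseteq> UNIV"
    then obtain m where "A \<subseteq> {..<m}" by (auto simp: finite_nat_iff_bounded)
    then show "\<forall>\<^sub>F n in sequentially. finite {..<n} \<and> A \<subseteq> {..<n} \<and> {..<n} \<subseteq> UNIV"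
      unfolding eventually_sequentially by (intro exI[of _ m]) auto
  qed
  from L2_tendsto_L2_lim[OF L2_tendsto_compose[OF S this]]
  show ?thesis by (simp add: stochastic_integral_def L2_suminf_def)
qed

lemma L2_tendsto_divergence_correction:
  assumes pred: "predictable X"
  shows "L2_tendsto P (\<lambda>n w. \<Sum>k<n. divergence_correction P v X i k w) (\<lambda>_. 0) sequentially"
proof -
  have Xk: "(\<lambda>w. X k w $ i) \<in> borel_measurable (past CARD('d) k)" for k
    using pred by (intro borel_measurable_vec_nth_comp) (simp add: predictable_def)
  have zero: "AE w in P. divergence_correction P v X i k w = 0" for k
    using gradient_past_zero(1)[OF Xk[of k]] by eventually_elim (simp add: divergence_correction_def)
  have meas: "divergence_correction P v X i k \<in> borel_measurable P" for k
    unfolding divergence_correction_def[abs_def] inner_vec_def inner_real_def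
    by (intro borel_measurable_sum borel_measurable_times gradient_past_zero(2)[OF Xk]
        past_borel[OF walk_measurable_past[OF lessI]])
  show ?thesis
  proof (rule L2_tendsto_eventually_AE_eq[OF L2_space_zero], rule always_eventually, intro allI conjI)
    fix n
    have "AE w in P. \<forall>k\<in>{..<n}. divergence_correction P v X i k w = 0"
      by (intro AE_finite_allI zero) simp
    then show ae: "AE w in P. (\<Sum>k<n. divergence_correction P v X i k w) = 0"
      by eventually_elim simp
    have m: "(\<lambda>w. \<Sum>k<n. divergence_correction P v X i k w) \<in> borel_measurable P"
      by (intro borel_measurable_sum meas)
    have "integrable P (\<lambda>w. (\<Sum>k<n. divergence_correction P v X i k w)\<^sup>2)"
    proof (rule integrable_cong_AE_imp[of _ "\<lambda>_. 0"])
      show "AE w in P. 0 = (\<Sum>k<n. divergence_correction P v X i k w)\<^sup>2"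
        using ae by eventually_elim simp
    qed (use m in auto)
    with m show "(\<lambda>w. \<Sum>k<n. divergence_correction P v X i k w) \<in> L2_space P"
      by (simp add: L2_space_def)
  qed
qed

end

theorem corollary8p4:
  fixes P :: "(nat \<Rightarrow> nat) measure"
    and v :: "nat \<Rightarrow> nat \<Rightarrow> (nat \<Rightarrow> nat) \<Rightarrow> real ^ 'd::finite"
    and X :: "nat \<Rightarrow> (nat \<Rightarrow> nat) \<Rightarrow> real ^ 'd"
  assumes "obtuse_random_walk P v"
    and "L2_process P X"
    and "predictable X"
  shows "X \<in> divergence_domain P v
    \<and> (AE w in P. divergence P v X w = stochastic_integral P v X w)
    \<and> L2_tendsto P (\<lambda>n w. \<Sum>k<n. X k w \<bullet> walk v k w) (stochastic_integral P v X) sequentially"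
proof -
  interpret obtuse_random_walk P v by (rule assms(1))
  note conv = stochastic_integral_converges[OF assms(2,3)]
  note corr = L2_tendsto_divergence_correction[OF assms(3)]
  have "AE w in P. \<forall>i. L2_suminf P (divergence_correction P v X i) w = 0"
    unfolding AE_all_countable L2_suminf_def
    by (intro allI L2_lim_AE_eq[OF corr]) simp
  then have "AE w in P. divergence P v X w = stochastic_integral P v X w"
    by eventually_elim (simp add: divergence_def stochastic_integral_def)
  moreover have "X \<in> divergence_domain P v"
    using assms(2) conv corr unfolding divergence_domain_def L2_summable_def by blast
  ultimately show ?thesis using conv by blast
qed

end
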